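(* The Kustaanheimo-Stiefel mapping $K.S.:(z,w)\mapsto\left(Q=\bar z i z,\ P=\dfrac{\bar z i w}{2|z|^2}\right)$ induces a symplectomorphism from $(V^1,\omega_1)$ to $\bigl(T^*(\mathbb{IH}\setminus\{0\}),\,Re\{d\bar P\wedge dQ\}\bigr)$.
   Context: $\mathbb{H}$ denotes the quaternions, $\mathbb{IH}\cong\mathbb{R}^3$ the purely imaginary quaternions, $Re$ the real part, $\bar z$ the conjugate. $T^*\mathbb{H}$ is identified with $\mathbb{H}\times\mathbb{H}\ni(z,w)$ (base point $z$, fibre $w$), and $T^*(\mathbb{IH}\setminus\{0\})$ with $\{(Q,P)\in\mathbb{IH}\times\mathbb{IH}:Q\neq0\}$. For quaternion-valued 1-forms, $\phi\wedge\psi(v,w)=\phi(v)\psi(w)-\phi(w)\psi(v)$ (quaternion product), so $Re\{d\bar w\wedge dz\}=\sum_{k=0}^3dw_k\wedge dz_k$ is the symplectic form on $T^*\mathbb{H}$, and similarly $Re\{d\bar P\wedge dQ\}=\sum_{k=1}^3dP_k\wedge dQ_k$. Let $BL(z,w)=Re\{\bar z i w\}$, $\Sigma=\{BL=0\}\subset\mathbb{H}\times\mathbb{H}$ and $\Sigma^1=\Sigma\setminus\{z=0\}$. The circle acts freely on $\Sigma^1$ by $(z,w)\mapsto(e^{i\vartheta}z,e^{i\vartheta}w)$; its orbits are the leaves of the characteristic foliation of $\Sigma^1$. $V^1=\Sigma^1/S^1$ is the quotient manifold, and $\omega_1$ is the symplectic form on $V^1$ obtained from $Re\{d\bar w\wedge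 dz\}$ by symplectic reduction (its pull-back to $\Sigma^1$ is $Re\{d\bar w\wedge dz\}|_{\Sigma^1}$). The mapping $K.S.$ is defined on $T^*(\mathbb{H}\setminus\{0\})$ with values in $\mathbb{IH}\times\mathbb{H}$; its restriction to $\Sigma^1$ takes values in $T^*(\mathbb{IH}\setminus\{0\})$ and is constant on $S^1$-orbits, and the induced map is the one on $V^1$. *)

theory Defs
  imports "HOL-Analysis.Analysis"
begin

section \<open>Quaternions\<close>

datatype quat = Quat (qRe: real) (qIm1: real) (qIm2: real) (qIm3: real)

lemma quat_eq_iff:
  "x = y \<longleftrightarrow> qRe x = qRe y \<and> qIm1 x = qIm1 y \<and> qIm2 x = qIm2 y \<and> qIm3 x = qIm3 y"
  by (cases x; cases y) auto

instantiation quat :: ring_1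
begin

definition zero_quat :: quat where "0 = Quat 0 0 0 0"

definition one_quat :: quat where "1 = Quat 1 0 0 0"

definition plus_quat :: "quat \<Rightarrow> quat \<Rightarrow> quat" where
  "x + y = Quat (qRe x + qRe y) (qIm1 x + qIm1 y) (qIm2 x + qIm2 y) (qIm3 x + qIm3 y)"

definition uminus_quat :: "quat \<Rightarrow> quat" where
  "- x = Quat (- qRe x) (- qIm1 x) (- qIm2 x) (- qIm3 x)"

definition minus_quat :: "quat \<Rightarrow> quat \<Rightarrow> quat" where
  "x - y = Quat (qRe x - qRe y) (qIm1 x - qIm1 y) (qIm2 x - qIm2 y) (qIm3 x - qIm3 y)"

definition times_quat :: "quat \<Rightarrow> quat \<Rightarrow> quat" where
  "x * y = Quat
     (qRe x * qRe y - qIm1 x * qIm1 y - qIm2 x * qIm2 y - qIm3 x * qIm3 y)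
     (qRe x * qIm1 y + qIm1 x * qRe y + qIm2 x * qIm3 y - qIm3 x * qIm2 y)
     (qRe x * qIm2 y - qIm1 x * qIm3 y + qIm2 x * qRe y + qIm3 x * qIm1 y)
     (qRe x * qIm3 y + qIm1 x * qIm2 y - qIm2 x * qIm1 y + qIm3 x * qRe y)"

instance
  by standard
    (simp_all add: quat_eq_iff zero_quat_def one_quat_def plus_quat_def uminus_quat_def
      minus_quat_def times_quat_def algebra_simps)

end

instantiation quat :: real_algebra_1
begin

definition scaleR_quat :: "real \<Rightarrow> quat \<Rightarrow> quat" where
  "r *\<^sub>R x = Quat (r * qRe x) (r * qIm1 x) (r * qIm2 x) (r * qIm3 x)"

instance
  by standard
    (simp_all add: quat_eq_iff plus_quat_def times_quat_def scaleR_quat_def algebra_simps)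

end

lemma quat_sel_simps [simp]:
  "qRe 0 = 0" "qIm1 0 = 0" "qIm2 0 = 0" "qIm3 0 = 0"
  "qRe 1 = 1" "qIm1 1 = 0" "qIm2 1 = 0" "qIm3 1 = 0"
  "qRe (x + y) = qRe x + qRe y" "qIm1 (x + y) = qIm1 x + qIm1 y"
  "qIm2 (x + y) = qIm2 x + qIm2 y" "qIm3 (x + y) = qIm3 x + qIm3 y"
  "qRe (x - y) = qRe x - qRe y" "qIm1 (x - y) = qIm1 x - qIm1 y"
  "qIm2 (x - y) = qIm2 x - qIm2 y" "qIm3 (x - y) = qIm3 x - qIm3 y"
  "qRe (- x) = - qRe x" "qIm1 (- x) = - qIm1 x" "qIm2 (- x) = - qIm2 x" "qIm3 (- x) = - qIm3 x"
  "qRe (r *\<^sub>R x) = r * qRe x" "qIm1 (r *\<^sub>R x) = r * qIm1 x"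
  "qIm2 (r *\<^sub>R x) = r * qIm2 x" "qIm3 (r *\<^sub>R x) = r * qIm3 x"
  by (simp_all add: zero_quat_def one_quat_def plus_quat_def minus_quat_def uminus_quat_def
      scaleR_quat_def)

lemma quat_times_sel [simp]:
  "qRe (x * y) = qRe x * qRe y - qIm1 x * qIm1 y - qIm2 x * qIm2 y - qIm3 x * qIm3 y"
  "qIm1 (x * y) = qRe x * qIm1 y + qIm1 x * qRe y + qIm2 x * qIm3 y - qIm3 x * qIm2 y"
  "qIm2 (x * y) = qRe x * qIm2 y - qIm1 x * qIm3 y + qIm2 x * qRe y + qIm3 x * qIm1 y"
  "qIm3 (x * y) = qRe x * qIm3 y + qIm1 x * qIm2 y - qIm2 x * qIm1 y + qIm3 x * qRe y"
  by (simp_all add: times_quat_def)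

instantiation quat :: real_inner
begin

definition inner_quat :: "quat \<Rightarrow> quat \<Rightarrow> real" where
  "inner x y = qRe x * qRe y + qIm1 x * qIm1 y + qIm2 x * qIm2 y + qIm3 x * qIm3 y"

definition norm_quat :: "quat \<Rightarrow> real" where "norm x = sqrt (inner x x)" for x :: quat

definition sgn_quat :: "quat \<Rightarrow> quat" where "sgn x = x /\<^sub>R norm x" for x :: quat

definition dist_quat :: "quat \<Rightarrow> quat \<Rightarrow> real" where "dist x y = norm (x - y)" for x y :: quat

definition uniformity_quat :: "(quat \<times> quat) filter" where
  "uniformity_quat = (INF e\<in>{0 <..}. principal {(x, y). dist x y < e})"

definition open_quat :: "quat set \<Rightarrow> bool" where
  "open_quat U \<longleftrightarrow> (\<forall>x\<in>U. eventually (\<lambda>(x', y). x' = x \<longrightarrow> y \<in> U) uniformity)"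

instance
proof
  fix x y z :: quat and r :: real
  show "inner x y = inner y x"
    by (simp add: inner_quat_def mult.commute)
  show "inner (x + y) z = inner x z + inner y z"
    by (simp add: inner_quat_def algebra_simps)
  show "inner (r *\<^sub>R x) y = r * inner x y"
    by (simp add: inner_quat_def algebra_simps)
  show "0 \<le> inner x x"
    by (simp add: inner_quat_def)
  show "inner x x = 0 \<longleftrightarrow> x = 0"
  proof
    assume "inner x x = 0"
    then have *: "qRe x * qRe x + qIm1 x * qIm1 x + qIm2 x * qIm2 x + qIm3 x * qIm3 x = 0"
      by (simp only: inner_quat_def)
    have "0 \<le> qRe x * qRe x" "0 \<le> qIm1 x * qIm1 x" "0 \<le> qIm2 x * qIm2 x" "0 \<le> qIm3 x * qIm3 x"
      by simp_all
    with * have "qRe x * qRe x = 0" "qIm1 x * qIm1 x = 0" "qIm2 x * qIm2 x = 0" "qIm3 x * qIm3 x = 0"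
      by linarith+
    then show "x = 0"
      by (simp only: quat_eq_iff mult_eq_0_iff quat_sel_simps) simp
  qed (simp add: inner_quat_def)
qed (rule norm_quat_def sgn_quat_def dist_quat_def open_quat_def uniformity_quat_def)+

end

instantiation quat :: euclidean_space
begin

definition Basis_quat :: "quat set" where
  "Basis = {Quat 1 0 0 0, Quat 0 1 0 0, Quat 0 0 1 0, Quat 0 0 0 1}"

instance
proof
  fix u v x :: quat
  show "Basis \<noteq> ({} :: quat set)" "finite (Basis :: quat set)"
    by (simp_all add: Basis_quat_def)
  show "u \<in> Basis \<Longrightarrow> v \<in> Basis \<Longrightarrow> inner u v = (if u = v then 1 else 0)"
    unfolding Basis_quat_def by (elim insertE emptyE) (simp_all add: inner_quat_def)
  show "(\<forall>u\<in>Basis. inner x u = 0) \<longleftrightarrow> x = 0"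
    unfolding Basis_quat_def by (cases x) (simp add: inner_quat_def zero_quat_def)
qed

end

instance quat :: real_normed_algebra_1
proof
  fix x y :: quat
  have "(norm (x * y))\<^sup>2 = (norm x * norm y)\<^sup>2"
    unfolding power_mult_distrib power2_norm_eq_inner inner_quat_def quat_times_sel by algebra
  then show "norm (x * y) \<le> norm x * norm y"
    by (metis mult_nonneg_nonneg norm_ge_zero order_refl power2_eq_imp_eq)
  show "norm (1 :: quat) = 1"
    by (simp add: norm_quat_def inner_quat_def)
qed

definition qi :: quat where "qi = Quat 0 1 0 0"

definition qcnj :: "quat \<Rightarrow> quat" where
  "qcnj x = Quat (qRe x) (- qIm1 x) (- qIm2 x) (- qIm3 x)"


section \<open>Smooth maps, charts and forms\<close>

text \<open>\<open>Ck_on k S f\<close> is intended for open \<open>S\<close>.\<close>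

primrec Ck_on ::
  "nat \<Rightarrow> 'a::euclidean_space set \<Rightarrow> ('a \<Rightarrow> 'b::real_normed_vector) \<Rightarrow> bool" where
  "Ck_on 0 S f \<longleftrightarrow> continuous_on S f"
| "Ck_on (Suc k) S f \<longleftrightarrow>
     (\<forall>x\<in>S. f differentiable (at x)) \<and>
     (\<forall>v. Ck_on k S (\<lambda>x. frechet_derivative f (at x) v))"

text \<open>Smoothness on an arbitrary subset of a Euclidean space: locally the restriction of a
  \<open>C\<^sup>\<infinity>\<close> map on an open set. For open \<open>S\<close> this is ordinary \<open>C\<^sup>\<infinity>\<close> smoothness.\<close>

definition smooth_on ::
  "'a::euclidean_space set \<Rightarrow> ('a \<Rightarrow> 'b::real_normed_vector) \<Rightarrow> bool" where
  "smooth_on S f \<longleftrightarrow>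
     (\<forall>x\<in>S. \<exists>W g. open W \<and> x \<in> W \<and> (\<forall>k. Ck_on k W g) \<and> (\<forall>y\<in>S \<inter> W. g y = f y))"

definition tangent_space :: "'a::euclidean_space set \<Rightarrow> 'a \<Rightarrow> 'a set" where
  "tangent_space S x =
     {v. \<exists>\<gamma> e. e > 0 \<and> smooth_on {-e<..<e} \<gamma> \<and> \<gamma> ` {-e<..<e} \<subseteq> S \<and> \<gamma> 0 = x \<and>
         (\<gamma> has_vector_derivative v) (at (0::real))}"

type_synonym ('m, 'e) chart = "'m set \<times> ('m \<Rightarrow> 'e)"

text \<open>All charts of an embedded submanifold: diffeomorphisms from relatively open subsets
  onto open subsets of the model space.\<close>

definition submanifold_charts ::
  "'a::euclidean_space set \<Rightarrow> ('a, 'e::euclidean_space) chart set" where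
  "submanifold_charts S =
     {(U, \<phi>). openin (top_of_set S) U \<and> inj_on \<phi> U \<and> open (\<phi> ` U) \<and>
        smooth_on U \<phi> \<and> smooth_on (\<phi> ` U) (inv_into U \<phi>)}"

text \<open>All charts of the quotient manifold \<open>\<pi> ` S\<close> of an embedded submanifold \<open>S\<close>, i.e. of the
  smooth structure that makes \<open>\<pi>\<close> a submersion: an injective \<open>\<phi>\<close> on an open set of the quotient
  topology is a chart iff \<open>\<phi> \<circ> \<pi>\<close> is a smooth submersion.
  A derivative \<open>D\<close> within \<open>S\<close> need not be unique as a linear map on the
  ambient space, but its values on the tangent space of \<open>S\<close> are.\<close>

definition quotient_charts ::
  "'a::euclidean_space set \<Rightarrow> ('a \<Rightarrow> 'm) \<Rightarrow> ('m, 'e::euclidean_space) chart set" where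
  "quotient_charts S \<pi> =
     {(U, \<phi>). U \<subseteq> \<pi> ` S \<and> openin (top_of_set S) (S \<inter> \<pi> -` U) \<and> inj_on \<phi> U \<and> open (\<phi> ` U) \<and>
        smooth_on (S \<inter> \<pi> -` U) (\<phi> \<circ> \<pi>) \<and>
        (\<forall>x\<in>S \<inter> \<pi> -` U. \<forall>D. ((\<phi> \<circ> \<pi>) has_derivative D) (at x within S) \<longrightarrow>
            D ` tangent_space S x = UNIV)}"

definition smooth_map ::
  "'m set \<Rightarrow> ('m, 'e::euclidean_space) chart set \<Rightarrow> ('n, 'f::euclidean_space) chart set \<Rightarrow>
   ('m \<Rightarrow> 'n) \<Rightarrow> bool" where
  "smooth_map M A B F \<longleftrightarrow>
     (\<forall>p\<in>M. \<exists>(U, \<phi>)\<in>A. \<exists>(V, \<psi>)\<in>B. p \<in> U \<and> F ` U \<subseteq> V \<and>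
        smooth_on (\<phi> ` U) (\<psi> \<circ> F \<circ> inv_into U \<phi>))"

definition diffeomorphism ::
  "'m set \<Rightarrow> ('m, 'e::euclidean_space) chart set \<Rightarrow>
   'n set \<Rightarrow> ('n, 'f::euclidean_space) chart set \<Rightarrow> ('m \<Rightarrow> 'n) \<Rightarrow> bool" where
  "diffeomorphism M A N B F \<longleftrightarrow>
     bij_betw F M N \<and> smooth_map M A B F \<and> smooth_map N B A (inv_into M F)"

text \<open>A 2-form on a manifold is given by its expressions in all charts:
  \<open>\<omega> (U, \<phi>) y\<close> is the bilinear form at \<open>y \<in> \<phi> ` U\<close>.\<close>

type_synonym ('m, 'e) form2 = "('m, 'e) chart \<Rightarrow> 'e \<Rightarrow> 'e \<Rightarrow> 'e \<Rightarrow> real"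

text \<open>Restriction (pull-back by the inclusion) of a constant-coefficient ambient 2-form to an
  embedded submanifold.\<close>

definition restrict_form ::
  "('a::euclidean_space \<Rightarrow> 'a \<Rightarrow> real) \<Rightarrow> ('a, 'e::euclidean_space) form2" where
  "restrict_form \<Omega> = (\<lambda>(U, \<phi>) y u v.
     \<Omega> (frechet_derivative (inv_into U \<phi>) (at y) u) (frechet_derivative (inv_into U \<phi>) (at y) v))"

text \<open>\<open>\<omega>\<close> is a reduced form: its pull-back by \<open>\<pi>\<close> to \<open>S\<close> is the restriction of \<open>\<Omega>\<close> to \<open>S\<close>.
  As \<open>\<phi> \<circ> \<pi>\<close> is a submersion, this determines \<open>\<omega> (U, \<phi>) y\<close> for all \<open>y \<in> \<phi> ` U\<close>.\<close>

definition reduced_form ::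
  "'a::euclidean_space set \<Rightarrow> ('a \<Rightarrow> 'm) \<Rightarrow> ('a \<Rightarrow> 'a \<Rightarrow> real) \<Rightarrow>
   ('m, 'e::euclidean_space) form2 \<Rightarrow> bool" where
  "reduced_form S \<pi> \<Omega> \<omega> \<longleftrightarrow>
     (\<forall>(U, \<phi>)\<in>quotient_charts S \<pi>. \<forall>x\<in>S \<inter> \<pi> -` U. \<forall>D.
        ((\<phi> \<circ> \<pi>) has_derivative D) (at x within S) \<longrightarrow>
        (\<forall>\<xi>\<in>tangent_space S x. \<forall>\<eta>\<in>tangent_space S x.
           \<omega> (U, \<phi>) (\<phi> (\<pi> x)) (D \<xi>) (D \<eta>) = \<Omega> \<xi> \<eta>))"

definition symplectomorphism ::
  "'m set \<Rightarrow> ('m, 'e::euclidean_space) chart set \<Rightarrow> ('m, 'e) form2 \<Rightarrow>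
   'n set \<Rightarrow> ('n, 'f::euclidean_space) chart set \<Rightarrow> ('n, 'f) form2 \<Rightarrow> ('m \<Rightarrow> 'n) \<Rightarrow> bool" where
  "symplectomorphism M A \<omega> N B \<eta> F \<longleftrightarrow>
     diffeomorphism M A N B F \<and>
     (\<forall>(U, \<phi>)\<in>A. \<forall>(V, \<psi>)\<in>B. \<forall>p\<in>U. F p \<in> V \<longrightarrow>
        (let D = frechet_derivative (\<psi> \<circ> F \<circ> inv_into U \<phi>) (at (\<phi> p))
         in \<forall>u v. \<eta> (V, \<psi>) (\<psi> (F p)) (D u) (D v) = \<omega> (U, \<phi>) (\<phi> p) u v))"


section \<open>The Kustaanheimo--Stiefel mapping\<close>

definition wedge :: "('a \<Rightarrow> quat) \<Rightarrow> ('a \<Rightarrow> quat) \<Rightarrow> 'a \<Rightarrow> 'a \<Rightarrow> quat" where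
  "wedge \<phi> \<psi> v w = \<phi> v * \<psi> w - \<phi> w * \<psi> v"

text \<open>On pairs (base point, fibre component) the differentials of the two coordinates are the
  projections, so this is both \<open>Re {d(conj w) \<and> dz}\<close> in the coordinates \<open>(z, w)\<close> and
  \<open>Re {d(conj P) \<and> dQ}\<close> in the coordinates \<open>(Q, P)\<close>.\<close>

definition canonical_form :: "quat \<times> quat \<Rightarrow> quat \<times> quat \<Rightarrow> real" where
  "canonical_form u v = qRe (wedge (\<lambda>x. qcnj (snd x)) fst u v)"

definition BL :: "quat \<times> quat \<Rightarrow> real" where
  "BL = (\<lambda>(z, w). qRe (qcnj z * qi * w))"

definition Sigma_BL :: "(quat \<times> quat) set" where
  "Sigma_BL = {x. BL x = 0}"

definition Sigma1 :: "(quat \<times> quat) set" where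
  "Sigma1 = Sigma_BL - {x. fst x = 0}"

definition orbit :: "quat \<times> quat \<Rightarrow> (quat \<times> quat) set" where
  "orbit = (\<lambda>(z, w). {(exp (\<theta> *\<^sub>R qi) * z, exp (\<theta> *\<^sub>R qi) * w) | \<theta>. True})"

definition V1 :: "(quat \<times> quat) set set" where
  "V1 = orbit ` Sigma1"

definition V1_charts :: "((quat \<times> quat) set, real^6) chart set" where
  "V1_charts = quotient_charts Sigma1 orbit"

definition omega1 :: "((quat \<times> quat) set, real^6) form2" where
  "omega1 = (SOME \<omega>. reduced_form Sigma1 orbit canonical_form \<omega>)"

definition TIH :: "(quat \<times> quat) set" where
  "TIH = {(Q, P). qRe Q = 0 \<and> qRe P = 0 \<and> Q \<noteq> 0}"

definition TIH_charts :: "(quat \<times> quat, real^6) chart set" where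
  "TIH_charts = submanifold_charts TIH"

definition KS :: "quat \<times> quat \<Rightarrow> quat \<times> quat" where
  "KS = (\<lambda>(z, w). (qcnj z * qi * z, (1 / (2 * (norm z)\<^sup>2)) *\<^sub>R (qcnj z * qi * w)))"

end

theory Submission
  imports Defs
begin

text \<open>Solving \<open>P = conj z i w / (2 |z|\<^sup>2)\<close> for the fibre variable gives \<open>w = -2 i z P\<close>, and the
  constraint \<open>Re (conj z i w) = 0\<close> says exactly that \<open>P\<close> is imaginary. Hence \<open>\<Sigma>\<^sup>1\<close> has
  coordinates \<open>(z, P)\<close>, in which the mapping is the Hopf map \<open>z \<mapsto> conj z i z\<close> with \<open>P\<close>
  carried along. The Hopf map is onto the imaginary quaternions, and its fibres over nonzero points are circle orbits;
  so the induced map is a bijection (\<open>KS_image_Sigma1\<close>, \<open>orbit_eq_iff_KS_eq\<close>). It is a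
  diffeomorphism because composing it with linear coordinates of the target gives a global chart of the
  quotient, the mapping being a submersion (\<open>coords_KS_quotient_chart\<close>).

  The symplectic forms agree by one algebraic identity, \<open>canonical_form_lift_tangent\<close>: substituting
  \<open>w = -2 i z P\<close> and its derivative into \<open>Re (d conj w \<and> dz)\<close> yields the canonical form in
  \<open>Q = conj z i z\<close> and \<open>P\<close>.

  The remaining work is that the forms are compared in all charts. In an arbitrary chart \<open>\<phi>\<close> of the
  quotient the induced map is locally the inverse of \<open>\<phi> \<circ> orbit \<circ> \<sigma>\<close> with \<open>\<sigma>\<close> an explicit local section
  (\<open>local_hopf_section\<close>), and a form of the inverse function theorem makes it differentiable
  (\<open>quotient_chart_compose_KS_quotient_inverse\<close>). Consequently the pull-back of the canonical form by
  the induced map is a reduced form on the quotient. Since reduced forms agree on the image of every chart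
  (\<open>reduced_form_unique\<close>), it coincides there with \<open>omega1\<close>.\<close>

section \<open>Quaternion algebra and the circle of unit complex numbers\<close>

lemma qcnj_sel [simp]:
  "qRe (qcnj x) = qRe x" "qIm1 (qcnj x) = - qIm1 x"
  "qIm2 (qcnj x) = - qIm2 x" "qIm3 (qcnj x) = - qIm3 x"
  by (simp_all add: qcnj_def)

lemma qi_sel [simp]: "qRe qi = 0" "qIm1 qi = 1" "qIm2 qi = 0" "qIm3 qi = 0"
  by (simp_all add: qi_def)

lemma norm_quat_squared:
  "(norm x)\<^sup>2 = (qRe x)\<^sup>2 + (qIm1 x)\<^sup>2 + (qIm2 x)\<^sup>2 + (qIm3 x)\<^sup>2" for x :: quat
  unfolding power2_norm_eq_inner by (simp add: inner_quat_def power2_eq_square)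

lemma norm_quat_mult: "norm (x * y) = norm x * norm y" for x y :: quat
proof -
  have "(norm (x * y))\<^sup>2 = (norm x * norm y)\<^sup>2"
    unfolding power_mult_distrib power2_norm_eq_inner inner_quat_def quat_times_sel by algebra
  then show ?thesis by (simp add: power2_eq_iff_nonneg)
qed

lemma norm_qcnj [simp]: "norm (qcnj x) = norm x"
  by (simp add: norm_quat_def inner_quat_def)

lemma norm_qi [simp]: "norm qi = 1"
  by (simp add: norm_quat_def inner_quat_def)

lemma qi_mult_qi: "qi * qi = - 1"
  by (simp add: quat_eq_iff)

lemma qcnj_mult: "qcnj (x * y) = qcnj y * qcnj x"
  by (simp add: quat_eq_iff algebra_simps)

lemma qcnj_scaleR: "qcnj (r *\<^sub>R x) = r *\<^sub>R qcnj x"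
  by (simp add: quat_eq_iff)

lemma mult_qcnj_self: "x * qcnj x = (norm x)\<^sup>2 *\<^sub>R 1"
  unfolding norm_quat_squared by (simp add: quat_eq_iff power2_eq_square)

lemma qcnj_mult_self: "qcnj x * x = (norm x)\<^sup>2 *\<^sub>R 1"
  unfolding norm_quat_squared by (simp add: quat_eq_iff power2_eq_square)

lemma bounded_linear_quat:
  "bounded_linear qRe" "bounded_linear qIm1" "bounded_linear qIm2" "bounded_linear qIm3"
  "bounded_linear qcnj"
  unfolding linear_conv_bounded_linear[symmetric]
  by (rule linearI; simp add: quat_eq_iff)+

text \<open>The subalgebra spanned by \<open>1\<close> and \<open>i\<close> is a copy of the complex numbers, so the
  exponential series is the image of the complex one.\<close>

lemma exp_scaleR_qi: "exp (\<theta> *\<^sub>R qi) = Quat (cos \<theta>) (sin \<theta>) 0 0"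
proof -
  define h where "h = (\<lambda>c :: complex. Quat (Re c) (Im c) 0 0)"
  have lin: "linear h"
    by (intro linearI) (simp_all add: h_def quat_eq_iff)
  then have bl: "bounded_linear h"
    by (rule linear_conv_bounded_linear[THEN iffD1])
  have pow: "h c ^ n = h (c ^ n)" for c n
    by (induction n) (simp_all add: h_def quat_eq_iff)
  have "(\<lambda>n. h ((\<i> * of_real \<theta>) ^ n /\<^sub>R fact n)) sums h (exp (\<i> * of_real \<theta>))"
    by (intro bounded_linear.sums[OF bl] exp_converges)
  moreover have "h ((\<i> * of_real \<theta>) ^ n /\<^sub>R fact n) = (\<theta> *\<^sub>R qi) ^ n /\<^sub>R fact n" for n
  proof -
    have "h (\<i> * of_real \<theta>) = \<theta> *\<^sub>R qi"
      by (simp add: h_def quat_eq_iff)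
    then show ?thesis
      using linear_scale[OF lin] pow[of "\<i> * of_real \<theta>" n] by simp
  qed
  ultimately have "(\<lambda>n. (\<theta> *\<^sub>R qi) ^ n /\<^sub>R fact n) sums h (exp (\<i> * of_real \<theta>))"
    by simp
  then have "exp (\<theta> *\<^sub>R qi) = h (exp (\<i> * of_real \<theta>))"
    by (rule sums_unique2[OF exp_converges])
  also have "exp (\<i> * complex_of_real \<theta>) = cis \<theta>"
    by (simp add: cis_conv_exp)
  finally show ?thesis
    by (simp add: h_def)
qed

section \<open>The constraint set over the Hopf map\<close>

lemma mem_Sigma1_iff: "x \<in> Sigma1 \<longleftrightarrow> fst x \<noteq> 0 \<and> qRe (qcnj (fst x) * qi * snd x) = 0"
  by (cases x) (auto simp: Sigma1_def Sigma_BL_def BL_def)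

text \<open>\<open>\<Sigma>\<^sup>1\<close> is parametrized by pairs \<open>(z, P)\<close> with \<open>z \<noteq> 0\<close> and \<open>P\<close> imaginary: multiplying
  \<open>conj z i w = 2 |z|\<^sup>2 P\<close> by \<open>z\<close> on the left and then by \<open>-i\<close> gives \<open>w = -2 i z P\<close>. In these
  coordinates the Kustaanheimo--Stiefel map only changes \<open>z\<close>, by the Hopf map
  \<open>z \<mapsto> conj z i z\<close>.\<close>

definition lift :: "quat \<Rightarrow> quat \<Rightarrow> quat \<times> quat" where
  "lift z P = (z, (-2) *\<^sub>R (qi * z * P))"

lemma KS_lift:
  assumes "z \<noteq> 0"
  shows "KS (lift z P) = (qcnj z * qi * z, P)"
proof -
  have "qcnj z * qi * (qi * z * P) = qcnj z * (qi * qi) * z * P"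
    by (simp only: mult.assoc)
  also have "\<dots> = - (norm z)\<^sup>2 *\<^sub>R P"
    by (simp add: qi_mult_qi qcnj_mult_self)
  finally show ?thesis
    using assms by (simp add: lift_def KS_def)
qed

lemma lift_KS:
  assumes "fst x \<noteq> 0"
  shows "lift (fst x) (snd (KS x)) = x"
proof -
  obtain z w where x: "x = (z, w)" by fastforce
  have "qi * z * (qcnj z * qi * w) = qi * (z * qcnj z) * qi * w"
    by (simp only: mult.assoc)
  also have "\<dots> = (norm z)\<^sup>2 *\<^sub>R (qi * qi * w)"
    by (simp add: mult_qcnj_self)
  finally show ?thesis
    using assms by (simp add: x lift_def KS_def qi_mult_qi)
qed

lemma qRe_conjugate_qi: "qRe (qcnj z * qi * z) = 0"
  by (simp add: algebra_simps)

lemma lift_in_Sigma1: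
  assumes "z \<noteq> 0" "qRe P = 0"
  shows "lift z P \<in> Sigma1"
proof -
  have "qRe (snd (KS (lift z P))) = 0"
    using assms by (simp add: KS_lift)
  then show ?thesis
    using assms(1) by (simp add: mem_Sigma1_iff KS_def lift_def del: quat_times_sel)
qed

lemma fst_KS: "fst (KS x) = qcnj (fst x) * qi * fst x"
  by (cases x) (simp add: KS_def)

lemma norm_fst_KS: "norm (fst (KS x)) = (norm (fst x))\<^sup>2"
  by (simp add: fst_KS norm_quat_mult power2_eq_square)

lemma KS_in_TIH:
  assumes "x \<in> Sigma1"
  shows "KS x \<in> TIH"
proof -
  have "norm (fst (KS x)) \<noteq> 0"
    using assms by (simp add: norm_fst_KS mem_Sigma1_iff)
  moreover have "qRe (snd (KS x)) = 0"
    using assms by (cases x) (simp add: KS_def mem_Sigma1_iff del: quat_times_sel)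
  ultimately show ?thesis
    using qRe_conjugate_qi[of "fst x"]
    by (auto simp: TIH_def fst_KS split_beta simp del: quat_times_sel)
qed

text \<open>For \<open>u = |Q| - i Q\<close> the product expands to \<open>|Q|\<^sup>2 i + 2 |Q| Q - Q i Q\<close>, and for imaginary
  \<open>Q\<close> the reflection formula \<open>Q i Q = |Q|\<^sup>2 i - 2 q\<^sub>1 Q\<close> (with \<open>q\<^sub>1\<close> the \<open>i\<close>-component)
  leaves a multiple of \<open>Q\<close>. After normalization this is a section of the Hopf map over the complement
  of the half-line of nonpositive multiples of \<open>i\<close>.\<close>

lemma hopf_formula:
  assumes "qRe Q = 0"
  defines "u \<equiv> norm Q *\<^sub>R 1 - qi * Q"
  shows "qcnj u * qi * u = (2 * (norm Q + qIm1 Q)) *\<^sub>R Q"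
proof -
  obtain a b c where Q: "Q = Quat 0 a b c"
    using assms(1) by (cases Q) auto
  define n where "n = norm Q"
  have n: "n\<^sup>2 = a\<^sup>2 + b\<^sup>2 + c\<^sup>2"
    unfolding n_def norm_quat_squared Q by simp
  show ?thesis
    unfolding u_def n_def[symmetric] using n
    by (simp add: Q quat_eq_iff) algebra
qed

lemma hopf_surjective:
  assumes "qRe Q = 0"
  obtains z where "qcnj z * qi * z = Q"
proof (cases "norm Q + qIm1 Q > 0")
  case True
  define u where "u = norm Q *\<^sub>R 1 - qi * Q"
  define c where "c = 1 / sqrt (2 * (norm Q + qIm1 Q))"
  have "qcnj (c *\<^sub>R u) * qi * (c *\<^sub>R u) = c\<^sup>2 *\<^sub>R (qcnj u * qi * u)"
    by (simp add: quat_eq_iff power2_eq_square algebra_simps)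
  also have "\<dots> = Q"
    using True unfolding u_def hopf_formula[OF assms] by (simp add: c_def power_divide)
  finally show ?thesis by (rule that)
next
  \<comment> \<open>Here \<open>Q = - |Q| i\<close>, which is the image of \<open>sqrt |Q| j\<close> because \<open>conj j i j = - i\<close>.\<close>
  case False
  define n where "n = norm Q"
  have n: "n\<^sup>2 = (qIm1 Q)\<^sup>2 + (qIm2 Q)\<^sup>2 + (qIm3 Q)\<^sup>2" "n \<ge> 0" "n \<le> - qIm1 Q"
    using False assms by (simp_all add: n_def norm_quat_squared)
  have "n\<^sup>2 \<le> (- qIm1 Q)\<^sup>2" by (rule power_mono) (use n in auto)
  have "(qIm2 Q)\<^sup>2 + (qIm3 Q)\<^sup>2 = 0"
    using n(1) \<open>n\<^sup>2 \<le> (- qIm1 Q)\<^sup>2\<close> zero_le_power2[of "qIm2 Q"] zero_le_power2[of "qIm3 Q"]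
    unfolding power2_minus by linarith
  then have 0: "qIm2 Q = 0" "qIm3 Q = 0" by (simp_all add: sum_power2_eq_zero_iff)
  have "qcnj (Quat 0 0 (sqrt (- qIm1 Q)) 0) * qi * Quat 0 0 (sqrt (- qIm1 Q)) 0 = Q"
    using 0 n assms by (simp add: quat_eq_iff)
  then show ?thesis by (rule that)
qed

lemma KS_image_Sigma1: "KS ` Sigma1 = TIH"
proof
  show "KS ` Sigma1 \<subseteq> TIH" using KS_in_TIH by blast
  show "TIH \<subseteq> KS ` Sigma1"
  proof
    fix y assume "y \<in> TIH"
    then obtain Q P where y: "y = (Q, P)" "qRe Q = 0" "qRe P = 0" "Q \<noteq> 0"
      by (auto simp: TIH_def)
    obtain z where z: "qcnj z * qi * z = Q" using hopf_surjective[OF y(2)] .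
    then have "z \<noteq> 0" using y(4) by auto
    then have "KS (lift z P) = y" "lift z P \<in> Sigma1"
      using KS_lift lift_in_Sigma1 z y by auto
    then show "y \<in> KS ` Sigma1" by blast
  qed
qed

text \<open>The explicit section is centred at \<open>i\<close>. The map \<open>T Q = z\<^sub>0 Q conj z\<^sub>0 / |z\<^sub>0|\<^sup>4\<close>
  carries \<open>conj z\<^sub>0 i z\<^sub>0\<close> to \<open>i\<close>, and if \<open>z'\<close> lies over \<open>T Q\<close> then \<open>z' z\<^sub>0\<close> lies over
  \<open>Q\<close>. The section is stated on an open set of all quaternions, so that its derivative is an ordinary one;
  it is a section at the imaginary points.\<close>

lemma local_hopf_section:
  assumes "z\<^sub>0 \<noteq> 0"
  obtains N s where "open N" "qcnj z\<^sub>0 * qi * z\<^sub>0 \<in> N" "s (qcnj z\<^sub>0 * qi * z\<^sub>0) = z\<^sub>0"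
    "continuous_on N s" "s differentiable (at (qcnj z\<^sub>0 * qi * z\<^sub>0))"
    "\<And>Q. Q \<in> N \<Longrightarrow> qRe Q = 0 \<Longrightarrow> s Q \<noteq> 0 \<and> qcnj (s Q) * qi * s Q = Q"
proof -
  define m where "m = (norm z\<^sub>0)\<^sup>2"
  have m: "m > 0" using assms by (simp add: m_def)
  define Q\<^sub>0 where "Q\<^sub>0 = qcnj z\<^sub>0 * qi * z\<^sub>0"
  define T where "T = (\<lambda>Q. (1 / m\<^sup>2) *\<^sub>R (z\<^sub>0 * Q * qcnj z\<^sub>0))"
  define r where "r = (\<lambda>Q. norm (T Q) + qIm1 (T Q))"
  define s where "s = (\<lambda>Q. (1 / sqrt (2 * r Q)) *\<^sub>R ((norm (T Q) *\<^sub>R 1 - qi * T Q) * z\<^sub>0))"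
  define N where "N = {Q. r Q > 0}"
  have linT: "bounded_linear T"
    unfolding T_def
    by (intro bounded_linear_intros)
  have contT: "continuous_on A T" for A by (intro linear_continuous_on linT)
  have contr: "continuous_on A r" for A
    unfolding r_def
    by (intro continuous_intros contT
        continuous_on_compose2[OF linear_continuous_on[OF bounded_linear_quat(2), of UNIV]]) auto
  have TQ0: "T Q\<^sub>0 = qi"
  proof -
    have "z\<^sub>0 * Q\<^sub>0 * qcnj z\<^sub>0 = (z\<^sub>0 * qcnj z\<^sub>0) * qi * (z\<^sub>0 * qcnj z\<^sub>0)"
      by (simp only: Q\<^sub>0_def mult.assoc)
    then show ?thesis
      using m by (simp add: T_def mult_qcnj_self m_def[symmetric]) (simp add: power2_eq_square)
  qed
  have "open N"
    unfolding N_def using contr[of UNIV] by (intro open_Collect_less) auto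
  moreover have "Q\<^sub>0 \<in> N"
    by (simp add: N_def r_def TQ0)
  moreover have "s Q\<^sub>0 = z\<^sub>0"
  proof -
    have "norm qi *\<^sub>R 1 - qi * qi = 2 *\<^sub>R (1 :: quat)"
      by (simp add: qi_mult_qi scaleR_2)
    moreover have "sqrt (2 * r Q\<^sub>0) = 2"
      by (simp add: r_def TQ0)
    ultimately show ?thesis
      unfolding s_def TQ0 by simp
  qed
  moreover have "continuous_on N s"
    unfolding s_def
    by (intro continuous_intros contT contr) (auto simp: N_def)
  moreover have "s differentiable (at Q\<^sub>0)"
  proof -
    have dT: "T differentiable (at Q\<^sub>0)" "(\<lambda>Q. qIm1 (T Q)) differentiable (at Q\<^sub>0)"
      using bounded_linear_imp_differentiable[OF linT]
        bounded_linear_imp_differentiable[OF bounded_linear_compose[OF bounded_linear_quat(2) linT]]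
      by auto
    have "qi \<noteq> 0"
      using norm_qi by fastforce
    then have dn: "(\<lambda>Q. norm (T Q)) differentiable (at Q\<^sub>0)"
      using differentiable_chain_at[OF dT(1), of norm] differentiable_norm_at[of "T Q\<^sub>0"]
      by (simp add: TQ0 o_def)
    have "(\<lambda>Q. 2 * r Q) differentiable (at Q\<^sub>0)"
      unfolding r_def by (intro differentiable_mult differentiable_const differentiable_add dn dT)
    moreover have "sqrt differentiable (at (2 * r Q\<^sub>0))"
      using DERIV_real_sqrt[of "2 * r Q\<^sub>0"]
      by (auto simp: r_def TQ0 real_differentiable_def)
    ultimately have "(\<lambda>Q. sqrt (2 * r Q)) differentiable (at Q\<^sub>0)"
      using differentiable_chain_at[of "\<lambda>Q. 2 * r Q" Q\<^sub>0 sqrt] by (simp add: o_def)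
    then have 1: "(\<lambda>Q. 1 / sqrt (2 * r Q)) differentiable (at Q\<^sub>0)"
      by (intro differentiable_divide differentiable_const) (auto simp: r_def TQ0)
    have "(\<lambda>Q. (norm (T Q) *\<^sub>R 1 - qi * T Q) * z\<^sub>0) differentiable (at Q\<^sub>0)"
      by (intro differentiable_mult differentiable_diff differentiable_scaleR
          differentiable_const dn dT)
    then show ?thesis
      unfolding s_def by (intro differentiable_scaleR 1)
  qed
  moreover have "s Q \<noteq> 0 \<and> qcnj (s Q) * qi * s Q = Q" if Q: "Q \<in> N" "qRe Q = 0" for Q
  proof -
    define u where "u = norm (T Q) *\<^sub>R 1 - qi * T Q"
    define c where "c = 1 / sqrt (2 * r Q)"
    have r: "r Q > 0" using Q by (simp add: N_def)
    have Re: "qRe (T Q) = 0"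
      using Q(2) by (simp add: T_def algebra_simps)
    have eq: "s Q = c *\<^sub>R (u * z\<^sub>0)"
      by (simp add: s_def u_def c_def)
    have "qcnj (s Q) * qi * s Q = c\<^sup>2 *\<^sub>R (qcnj z\<^sub>0 * (qcnj u * qi * u) * z\<^sub>0)"
      unfolding eq by (simp add: qcnj_scaleR qcnj_mult mult.assoc power2_eq_square)
    also have "\<dots> = qcnj z\<^sub>0 * T Q * z\<^sub>0"
    proof -
      have "qcnj u * qi * u = (2 * r Q) *\<^sub>R T Q"
        using hopf_formula[OF Re] by (simp add: u_def r_def)
      then show ?thesis
        using r by (simp add: c_def power_divide)
    qed
    also have "\<dots> = (1 / m\<^sup>2) *\<^sub>R ((qcnj z\<^sub>0 * z\<^sub>0) * Q * (qcnj z\<^sub>0 * z\<^sub>0))"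
      by (simp add: T_def mult.assoc)
    also have "\<dots> = Q"
      using m by (simp add: qcnj_mult_self m_def[symmetric]) (simp add: power2_eq_square)
    finally have 1: "qcnj (s Q) * qi * s Q = Q" .
    have "T 0 = 0" using linT by (simp add: linear_simps)
    then have "Q \<noteq> 0" using r by (auto simp: r_def)
    then show ?thesis using 1 by auto
  qed
  ultimately show thesis
    by (rule that[of N s, folded Q\<^sub>0_def])
qed

section \<open>Circle orbits as fibres\<close>

lemma mem_orbit_iff:
  "y \<in> orbit x \<longleftrightarrow> (\<exists>\<theta>. y = (exp (\<theta> *\<^sub>R qi) * fst x, exp (\<theta> *\<^sub>R qi) * snd x))"
  by (cases x) (auto simp: orbit_def)

lemma exp_qi_add: "exp (\<theta> *\<^sub>R qi) * exp (\<tau> *\<^sub>R qi) = exp ((\<theta> + \<tau>) *\<^sub>R qi)"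
  by (simp add: exp_scaleR_qi quat_eq_iff cos_add sin_add)

lemma self_mem_orbit: "x \<in> orbit x"
  unfolding mem_orbit_iff by (rule exI[of _ 0]) (cases x, simp)

lemma orbit_eq_iff: "orbit x = orbit y \<longleftrightarrow> y \<in> orbit x"
proof
  show "orbit x = orbit y \<Longrightarrow> y \<in> orbit x" using self_mem_orbit by auto
  assume "y \<in> orbit x"
  then obtain t where y: "y = (exp (t *\<^sub>R qi) * fst x, exp (t *\<^sub>R qi) * snd x)"
    by (auto simp: mem_orbit_iff)
  have "p \<in> orbit x \<longleftrightarrow> p \<in> orbit y" for p
  proof
    assume "p \<in> orbit y"
    then obtain u where "p = (exp (u *\<^sub>R qi) * fst y, exp (u *\<^sub>R qi) * snd y)"
      by (auto simp: mem_orbit_iff)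
    then show "p \<in> orbit x"
      unfolding mem_orbit_iff y
      by (intro exI[of _ "u + t"]) (simp add: mult.assoc[symmetric] exp_qi_add)
  next
    assume "p \<in> orbit x"
    then obtain u where "p = (exp (u *\<^sub>R qi) * fst x, exp (u *\<^sub>R qi) * snd x)"
      by (auto simp: mem_orbit_iff)
    then show "p \<in> orbit y"
      unfolding mem_orbit_iff y
      by (intro exI[of _ "u - t"]) (simp add: mult.assoc[symmetric] exp_qi_add)
  qed
  then show "orbit x = orbit y" by blast
qed

lemma lift_rotate:
  "lift (exp (t *\<^sub>R qi) * z) P = (exp (t *\<^sub>R qi) * z, exp (t *\<^sub>R qi) * snd (lift z P))"
proof -
  let ?e = "exp (t *\<^sub>R qi)"
  have "qi * (?e * z) * P = (qi * ?e) * z * P"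
    by (simp only: mult.assoc)
  also have "qi * ?e = ?e * qi"
    unfolding exp_scaleR_qi quat_eq_iff by simp
  also have "?e * qi * z * P = ?e * (qi * z * P)"
    by (simp only: mult.assoc)
  finally show ?thesis
    unfolding lift_def by (simp only: snd_conv mult_scaleR_right)
qed

lemma hopf_rotate: "qcnj (exp (t *\<^sub>R qi) * z) * qi * (exp (t *\<^sub>R qi) * z) = qcnj z * qi * z"
proof -
  have "qcnj (exp (t *\<^sub>R qi)) * qi * exp (t *\<^sub>R qi) = qi"
    using sin_cos_squared_add[of t] by (simp add: exp_scaleR_qi quat_eq_iff power2_eq_square)
  moreover have "qcnj (exp (t *\<^sub>R qi) * z) * qi * (exp (t *\<^sub>R qi) * z)
    = qcnj z * (qcnj (exp (t *\<^sub>R qi)) * qi * exp (t *\<^sub>R qi)) * z"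
    by (simp only: qcnj_mult mult.assoc)
  ultimately show ?thesis by simp
qed

text \<open>Let \<open>u = y z\<^sup>-\<^sup>1\<close>. Equality of the images gives \<open>|y| = |z|\<close> and that \<open>u\<close> commutes with
  \<open>i\<close>; hence \<open>u\<close> is a complex number of modulus one.\<close>

lemma hopf_fibre:
  assumes "z \<noteq> 0" "qcnj y * qi * y = qcnj z * qi * z"
  obtains t where "y = exp (t *\<^sub>R qi) * z"
proof -
  define m where "m = (norm z)\<^sup>2"
  have m: "m > 0" using assms(1) by (simp add: m_def)
  have "norm (qcnj y * qi * y) = norm (qcnj z * qi * z)" using assms(2) by simp
  then have ny: "(norm y)\<^sup>2 = m"
    by (simp add: norm_quat_mult m_def power2_eq_square)
  define u where "u = (1 / m) *\<^sub>R (y * qcnj z)"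
  have uz: "y = u * z"
    using m by (simp add: u_def mult.assoc qcnj_mult_self m_def[symmetric])
  have "(y * qcnj y) * qi * (y * qcnj z) = y * (qcnj y * qi * y) * qcnj z"
    by (simp only: mult.assoc)
  also have "\<dots> = y * qcnj z * qi * (z * qcnj z)"
    unfolding assms(2) by (simp only: mult.assoc)
  finally have "m *\<^sub>R (qi * (y * qcnj z)) = m *\<^sub>R (y * qcnj z * qi)"
    by (simp add: mult_qcnj_self ny m_def[symmetric])
  then have comm: "qi * u = u * qi"
    using m by (simp add: u_def)
  have u0: "qIm2 u = 0" "qIm3 u = 0"
    using arg_cong[OF comm, of qIm2] arg_cong[OF comm, of qIm3] by auto
  have "norm u = 1"
    using m ny arg_cong[OF uz, of norm] by (simp add: norm_quat_mult m_def)
  then have "(qRe u)\<^sup>2 + (qIm1 u)\<^sup>2 = 1"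
    using norm_quat_squared[of u] u0 by simp
  then obtain t where "qRe u = cos t" "qIm1 u = sin t"
    using sincos_total_2pi by metis
  then have "u = exp (t *\<^sub>R qi)"
    using u0 by (simp add: exp_scaleR_qi quat_eq_iff)
  then show thesis using uz that by blast
qed

text \<open>Through \<open>w = -2 i z P\<close> the claim reduces to the fibres of the Hopf map, because a unit
  complex number that rotates \<open>z\<close> commutes with \<open>i\<close> and so rotates \<open>w\<close> in the same way.\<close>

lemma orbit_eq_iff_KS_eq:
  assumes x: "x \<in> Sigma1" and y: "y \<in> Sigma1"
  shows "orbit x = orbit y \<longleftrightarrow> KS x = KS y"
proof
  have 0: "fst x \<noteq> 0" "fst y \<noteq> 0" using x y by (simp_all add: mem_Sigma1_iff)
  note lift = lift_KS[OF 0(1)] lift_KS[OF 0(2)]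
  {
    assume "orbit x = orbit y"
    then obtain t where t: "y = (exp (t *\<^sub>R qi) * fst x, exp (t *\<^sub>R qi) * snd x)"
      by (auto simp: orbit_eq_iff mem_orbit_iff)
    have "y = lift (exp (t *\<^sub>R qi) * fst x) (snd (KS x))"
      by (simp add: lift_rotate lift t)
    moreover have "fst y = exp (t *\<^sub>R qi) * fst x" using t by simp
    ultimately have "y = lift (fst y) (snd (KS x))" by metis
    then have "KS y = KS (lift (fst y) (snd (KS x)))" by (rule arg_cong)
    also have "\<dots> = (qcnj (fst y) * qi * fst y, snd (KS x))"
      using 0 by (simp add: KS_lift)
    also have "\<dots> = KS x"
      using fst_KS[of x] by (simp add: t hopf_rotate prod_eq_iff)
    finally show "KS x = KS y" by simp
  next
    assume eq: "KS x = KS y"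
    then have "qcnj (fst y) * qi * fst y = qcnj (fst x) * qi * fst x"
      by (metis fst_KS)
    then obtain t where t: "fst y = exp (t *\<^sub>R qi) * fst x"
      using hopf_fibre 0 by metis
    have "y = lift (exp (t *\<^sub>R qi) * fst x) (snd (KS x))"
      using lift t eq by simp
    also have "\<dots> = (exp (t *\<^sub>R qi) * fst x, exp (t *\<^sub>R qi) * snd x)"
      by (simp add: lift_rotate lift)
    finally show "orbit x = orbit y"
      by (auto simp: orbit_eq_iff mem_orbit_iff)
  }
qed

section \<open>Calculus of smooth maps\<close>

lemma Ck_on_cong:
  assumes "open S" "\<And>x. x \<in> S \<Longrightarrow> f x = g x" "Ck_on k S f"
  shows "Ck_on k S g"
  using assms(2,3)
proof (induction k arbitrary: f g)
  case 0
  then show ?case using continuous_on_eq by auto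
next
  case (Suc k)
  have der: "(g has_derivative frechet_derivative f (at x)) (at x)" if x: "x \<in> S" for x
    using Suc.prems(2) x has_derivative_transform_within_open[OF _ assms(1) x Suc.prems(1)]
    by (auto simp: frechet_derivative_works)
  have "g differentiable (at x)" if "x \<in> S" for x
    using der[OF that] by (rule differentiableI)
  moreover have "Ck_on k S (\<lambda>x. frechet_derivative g (at x) v)" for v
  proof (rule Suc.IH)
    show "Ck_on k S (\<lambda>x. frechet_derivative f (at x) v)" using Suc.prems(2) by simp
    show "frechet_derivative f (at x) v = frechet_derivative g (at x) v" if "x \<in> S" for x
      using frechet_derivative_at[OF der[OF that]] by simp
  qed
  ultimately show ?case by simp
qed

text \<open>Together with \<open>Ck_on_SucE\<close> this lets the inductions on \<open>k\<close> below work with explicit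
  derivatives in place of the chosen \<open>frechet_derivative\<close>.\<close>

lemma Ck_on_SucI:
  assumes "open S" "\<And>x. x \<in> S \<Longrightarrow> (f has_derivative f' x) (at x)"
    and "\<And>v. Ck_on k S (\<lambda>x. f' x v)"
  shows "Ck_on (Suc k) S f"
proof -
  have "Ck_on k S (\<lambda>x. frechet_derivative f (at x) v)" for v
    by (rule Ck_on_cong[OF assms(1) _ assms(3)[of v]])
      (use frechet_derivative_at[OF assms(2)] in simp)
  moreover have "f differentiable (at x)" if "x \<in> S" for x
    using assms(2)[OF that] by (rule differentiableI)
  ultimately show ?thesis by simp
qed

lemma Ck_on_SucD: "Ck_on (Suc k) S f \<Longrightarrow> Ck_on k S f"
proof (induction k arbitrary: f)
  case 0
  then show ?case
    by (auto intro: continuous_at_imp_continuous_on differentiable_imp_continuous_within)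
next
  case (Suc k)
  show ?case
    unfolding Ck_on.simps(2)[of k]
    using Suc.prems Suc.IH by (simp only: Ck_on.simps(2)[of "Suc k"]) blast
qed

lemma Ck_on_SucE:
  assumes "Ck_on (Suc k) S f"
  obtains f' where "\<And>x. x \<in> S \<Longrightarrow> (f has_derivative f' x) (at x)" "\<And>v. Ck_on k S (\<lambda>x. f' x v)"
  using assms that[of "\<lambda>x. frechet_derivative f (at x)"] by (simp add: frechet_derivative_works)

lemma Ck_on_const: "open S \<Longrightarrow> Ck_on k S (\<lambda>x. c)"
proof (induction k arbitrary: c)
  case (Suc k)
  show ?case
    by (rule Ck_on_SucI[where f' = "\<lambda>x v. 0"]) (use Suc in auto)
qed simp

lemma Ck_on_linear:
  assumes "bounded_linear L" "open S"
  shows "Ck_on k S L"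
proof (cases k)
  case 0
  then show ?thesis by (simp add: linear_continuous_on assms)
next
  case (Suc j)
  show ?thesis
    unfolding Suc
    by (rule Ck_on_SucI[where f' = "\<lambda>x. L"])
      (use assms in \<open>auto intro: Ck_on_const bounded_linear_imp_has_derivative\<close>)
qed

lemma Ck_on_add:
  assumes "open S" "Ck_on k S f" "Ck_on k S g"
  shows "Ck_on k S (\<lambda>x. f x + g x)"
  using assms(2,3)
proof (induction k arbitrary: f g)
  case (Suc k)
  obtain f' where f: "\<And>x. x \<in> S \<Longrightarrow> (f has_derivative f' x) (at x)" "\<And>v. Ck_on k S (\<lambda>x. f' x v)"
    using Ck_on_SucE[OF Suc.prems(1)] by metis
  obtain g' where g: "\<And>x. x \<in> S \<Longrightarrow> (g has_derivative g' x) (at x)" "\<And>v. Ck_on k S (\<lambda>x. g' x v)"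
    using Ck_on_SucE[OF Suc.prems(2)] by metis
  show ?case
    by (rule Ck_on_SucI[OF assms(1) has_derivative_add[OF f(1) g(1)] Suc.IH[OF f(2) g(2)]])
qed (auto intro: continuous_intros)

lemma Ck_on_bilinear:
  assumes pr: "bounded_bilinear pr" and "open S" "Ck_on k S f" "Ck_on k S g"
  shows "Ck_on k S (\<lambda>x. pr (f x) (g x))"
  using assms(3,4)
proof (induction k arbitrary: f g)
  case 0
  then show ?case using bounded_bilinear.continuous_on[OF pr] by simp
next
  case (Suc k)
  obtain f' where f: "\<And>x. x \<in> S \<Longrightarrow> (f has_derivative f' x) (at x)" "\<And>v. Ck_on k S (\<lambda>x. f' x v)"
    using Ck_on_SucE[OF Suc.prems(1)] by metis
  obtain g' where g: "\<And>x. x \<in> S \<Longrightarrow> (g has_derivative g' x) (at x)" "\<And>v. Ck_on k S (\<lambda>x. g' x v)"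
    using Ck_on_SucE[OF Suc.prems(2)] by metis
  show ?case
    by (rule Ck_on_SucI[OF assms(2) bounded_bilinear.FDERIV[OF pr f(1) g(1)]
          Ck_on_add[OF assms(2) Suc.IH[OF _ g(2)] Suc.IH[OF f(2)]]])
      (use Suc.prems[THEN Ck_on_SucD] in auto)
qed

lemma Ck_on_linear_compose:
  assumes L: "bounded_linear L" and "open S" "Ck_on k S f"
  shows "Ck_on k S (\<lambda>x. L (f x))"
  using assms(3)
proof (induction k arbitrary: f)
  case 0
  then show ?case using bounded_linear.continuous_on[OF L] by simp
next
  case (Suc k)
  obtain f' where f: "\<And>x. x \<in> S \<Longrightarrow> (f has_derivative f' x) (at x)" "\<And>v. Ck_on k S (\<lambda>x. f' x v)"
    using Ck_on_SucE[OF Suc.prems(1)] by metis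
  show ?case
    by (rule Ck_on_SucI[OF assms(2) bounded_linear.has_derivative[OF L f(1)] Suc.IH[OF f(2)]])
qed

text \<open>Since \<open>(1/f)' = - (1/f) f' (1/f)\<close>, the claim for \<open>k\<close> gives the one for \<open>Suc k\<close>.\<close>

lemma Ck_on_inverse:
  fixes f :: "'a::euclidean_space \<Rightarrow> real"
  assumes "open S" "\<And>x. x \<in> S \<Longrightarrow> f x \<noteq> 0" "Ck_on k S f"
  shows "Ck_on k S (\<lambda>x. inverse (f x))"
  using assms(3)
proof (induction k)
  case 0
  then show ?case using assms(2) by (auto intro: continuous_on_inverse)
next
  case (Suc k)
  obtain f' where f: "\<And>x. x \<in> S \<Longrightarrow> (f has_derivative f' x) (at x)" "\<And>v. Ck_on k S (\<lambda>x. f' x v)"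
    using Ck_on_SucE[OF Suc.prems(1)] by metis
  note inv = Suc.IH[OF Suc.prems[THEN Ck_on_SucD]]
  show ?case
  proof (rule Ck_on_SucI[OF assms(1)])
    show "((\<lambda>x. inverse (f x)) has_derivative (\<lambda>v. - (inverse (f x) * f' x v * inverse (f x)))) (at x)"
      if "x \<in> S" for x
      using f(1)[OF that] assms(2)[OF that] by (rule Deriv.has_derivative_inverse[rotated])
    show "Ck_on k S (\<lambda>x. - (inverse (f x) * f' x v * inverse (f x)))" for v
      by (rule Ck_on_linear_compose[OF bounded_linear_minus[OF bounded_linear_ident] assms(1)
          Ck_on_bilinear[OF bounded_bilinear_mult assms(1)
            Ck_on_bilinear[OF bounded_bilinear_mult assms(1) inv f(2)] inv]])
  qed
qed

lemma Ck_on_Pair: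
  assumes "open S" "Ck_on k S f" "Ck_on k S g"
  shows "Ck_on k S (\<lambda>x. (f x, g x))"
proof -
  have "bounded_linear (\<lambda>y. (y, 0))" "bounded_linear (\<lambda>y. (0, y))"
    by (intro bounded_linear_Pair bounded_linear_ident bounded_linear_zero)+
  from Ck_on_add[OF assms(1) Ck_on_linear_compose[OF this(1) assms(1,2)]
      Ck_on_linear_compose[OF this(2) assms(1,3)]]
  show ?thesis by simp
qed

lemma Ck_on_KS: "Ck_on k {x. fst x \<noteq> 0} KS"
proof -
  let ?S = "{x :: quat \<times> quat. fst x \<noteq> 0}"
  have S: "open ?S"
    by (intro open_Collect_neq continuous_intros)
  have z: "Ck_on k ?S fst" and w: "Ck_on k ?S snd"
    by (rule Ck_on_linear[OF bounded_linear_fst S] Ck_on_linear[OF bounded_linear_snd S])+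
  have zc: "Ck_on k ?S (\<lambda>x. qcnj (fst x) * qi)"
    by (rule Ck_on_bilinear[OF bounded_bilinear_mult S
          Ck_on_linear_compose[OF bounded_linear_quat(5) S z] Ck_on_const[OF S]])
  have "Ck_on k ?S (\<lambda>x. (qcnj (fst x) * qi * fst x,
      inverse (2 * (fst x \<bullet> fst x)) *\<^sub>R (qcnj (fst x) * qi * snd x)))"
  proof (rule Ck_on_Pair[OF S Ck_on_bilinear[OF bounded_bilinear_mult S zc z]
        Ck_on_bilinear[OF bounded_bilinear_scaleR S Ck_on_inverse[OF S]
          Ck_on_bilinear[OF bounded_bilinear_mult S zc w]]])
    show "Ck_on k ?S (\<lambda>x. 2 * (fst x \<bullet> fst x))"
      by (rule Ck_on_bilinear[OF bounded_bilinear_mult S Ck_on_const[OF S]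
            Ck_on_bilinear[OF bounded_bilinear_inner S z z]])
  qed simp
  then show ?thesis
    by (rule Ck_on_cong[OF S, rotated])
       (auto simp: KS_def power2_norm_eq_inner inverse_eq_divide)
qed

lemma smooth_onI_open:
  assumes "open W" "S \<subseteq> W" "\<And>k. Ck_on k W f"
  shows "smooth_on S f"
  using assms unfolding smooth_on_def by blast

lemma smooth_on_cong:
  assumes "\<And>x. x \<in> S \<Longrightarrow> f x = g x" "smooth_on S f"
  shows "smooth_on S g"
  unfolding smooth_on_def
proof
  fix x assume "x \<in> S"
  then obtain W h where "open W" "x \<in> W" "\<forall>k. Ck_on k W h" "\<forall>y\<in>S \<inter> W. h y = f y"
    using assms(2) unfolding smooth_on_def by blast
  then show "\<exists>W h. open W \<and> x \<in> W \<and> (\<forall>k. Ck_on k W h) \<and> (\<forall>y\<in>S \<inter> W. h y = g y)"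
    using assms(1) by (intro exI[of _ W] exI[of _ h]) auto
qed

lemma smooth_on_local_extension:
  assumes "smooth_on S f" "x \<in> S"
  obtains W g D where "open W" "x \<in> W" "(g has_derivative D) (at x)"
    "\<And>y. y \<in> S \<Longrightarrow> y \<in> W \<Longrightarrow> g y = f y"
proof -
  obtain W g where W: "open W" "x \<in> W" "\<forall>k. Ck_on k W g" "\<forall>y\<in>S \<inter> W. g y = f y"
    using assms unfolding smooth_on_def by blast
  have "Ck_on (Suc 0) W g" using W(3) by blast
  then have "(g has_derivative frechet_derivative g (at x)) (at x)"
    using W(2) by (simp add: frechet_derivative_works)
  then show thesis using that W by blast
qed

text \<open>Smoothness on a subset supplies an extension \<open>g\<close> with a derivative in the ambient space; this
  transfers that derivative to the function itself, within the subset.\<close>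

lemma has_derivative_within_agree:
  assumes "(g has_derivative D) (at x)" "open W" "x \<in> W" "x \<in> S"
    and "\<And>y. y \<in> S \<Longrightarrow> y \<in> W \<Longrightarrow> g y = f y"
  shows "(f has_derivative D) (at x within S)"
proof -
  obtain e where "e > 0" "\<And>y. dist y x < e \<Longrightarrow> y \<in> W"
    using assms(2,3) by (auto simp: open_dist)
  then show ?thesis
    using has_derivative_transform_within[OF has_derivative_at_withinI[OF assms(1)], of e S f] assms(4,5)
    by auto
qed

lemma smooth_on_imp_has_derivative:
  assumes "smooth_on S f" "x \<in> S"
  obtains D where "(f has_derivative D) (at x within S)"
proof -
  obtain W g D where "open W" "x \<in> W" "(g has_derivative D) (at x)"
    "\<And>y. y \<in> S \<Longrightarrow> y \<in> W \<Longrightarrow> g y = f y"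
    by (rule smooth_on_local_extension[OF assms]) blast
  then show thesis
    using that has_derivative_within_agree[of g D x W S f] assms(2) by blast
qed

lemma smooth_on_imp_continuous_on:
  assumes "smooth_on S f"
  shows "continuous_on S f"
  unfolding continuous_on_eq_continuous_within
proof
  fix x assume "x \<in> S"
  then obtain D where "(f has_derivative D) (at x within S)"
    using smooth_on_imp_has_derivative[OF assms] by blast
  then show "continuous (at x within S) f" by (rule has_derivative_continuous)
qed

section \<open>Tangent vectors as velocities\<close>

lemma tangent_spaceE:
  assumes "v \<in> tangent_space S x"
  obtains \<gamma> where "\<forall>\<^sub>F t in nhds 0. \<gamma> t \<in> S" "\<gamma> 0 = x" "(\<gamma> has_vector_derivative v) (at 0)"
proof -
  obtain \<gamma> e where \<gamma>: "e > 0" "\<gamma> ` {-e<..<e} \<subseteq> S" "\<gamma> 0 = x" "(\<gamma> has_vector_derivative v) (at (0::real))"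
    using assms unfolding tangent_space_def by blast
  have "\<forall>\<^sub>F t in nhds 0. t \<in> {-e<..<e}"
    by (rule eventually_nhds_in_open) (use \<gamma>(1) in auto)
  then have "\<forall>\<^sub>F t in nhds 0. \<gamma> t \<in> S"
    by eventually_elim (use \<gamma>(2) in auto)
  then show thesis using \<gamma> that by blast
qed

lemma has_vector_derivative_eventually_eq:
  assumes "(f has_vector_derivative v) (at x)" "\<forall>\<^sub>F t in nhds x. f t = g t"
  shows "(g has_vector_derivative v) (at x)"
proof -
  obtain S where "open S" "x \<in> S" "\<And>t. t \<in> S \<Longrightarrow> f t = g t"
    using assms(2) unfolding eventually_nhds by blast
  then show ?thesis
    using has_vector_derivative_transform_within_open[OF assms(1)] by blast
qed

lemma has_vector_derivative_along_curve:
  assumes "(\<gamma> has_vector_derivative v) (at t)" "\<forall>\<^sub>F s in nhds t. \<gamma> s \<in> S"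
    and "(f has_derivative D) (at (\<gamma> t) within S)"
  shows "((\<lambda>s. f (\<gamma> s)) has_vector_derivative D v) (at t)"
proof -
  obtain A where A: "open A" "t \<in> A" "\<And>s. s \<in> A \<Longrightarrow> \<gamma> s \<in> S"
    using assms(2) unfolding eventually_nhds by blast
  have "((f \<circ> \<gamma>) has_vector_derivative D v) (at t within A)"
  proof (rule vector_derivative_diff_chain_within)
    show "(\<gamma> has_vector_derivative v) (at t within A)"
      using assms(1) by (rule has_vector_derivative_at_within)
    show "(f has_derivative D) (at (\<gamma> t) within \<gamma> ` A)"
      using assms(3) by (rule has_derivative_subset) (use A(3) in blast)
  qed
  then show ?thesis
    by (simp only: at_within_open[OF A(2,1)] o_def)
qed

section \<open>The differential of the Kustaanheimo--Stiefel map\<close>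

lemma has_vector_derivative_hopf:
  assumes "(f has_vector_derivative \<zeta>) (at t)"
  shows "((\<lambda>t. qcnj (f t) * qi * f t) has_vector_derivative
    qcnj \<zeta> * qi * f t + qcnj (f t) * qi * \<zeta>) (at t)"
proof -
  have "((\<lambda>t. qcnj (f t) * qi) has_vector_derivative qcnj \<zeta> * qi) (at t)"
    using bounded_linear.has_vector_derivative[OF
        bounded_linear_mult_const[OF bounded_linear_quat(5), of qi] assms] .
  from has_vector_derivative_mult[OF this assms] show ?thesis
    by (simp add: add.commute)
qed

text \<open>This is the computation that makes the map symplectic. The vectors on the right are the derivatives
  of \<open>(z, -2 i z P)\<close> along \<open>(\<zeta>\<^sub>k, p\<^sub>k)\<close>. The terms with \<open>P\<close> cancel, because
  \<open>Re (P conj \<zeta>\<^sub>1 i \<zeta>\<^sub>2)\<close> is symmetric in \<open>\<zeta>\<^sub>1, \<zeta>\<^sub>2\<close> for imaginary \<open>P\<close>, and both sides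
  equal \<open>2 Re (p\<^sub>2 conj z i \<zeta>\<^sub>1) - 2 Re (p\<^sub>1 conj z i \<zeta>\<^sub>2)\<close>.\<close>

lemma canonical_form_lift_tangent:
  assumes "qRe P = 0" "qRe p\<^sub>1 = 0" "qRe p\<^sub>2 = 0"
  shows "canonical_form (qcnj \<zeta>\<^sub>1 * qi * z + qcnj z * qi * \<zeta>\<^sub>1, p\<^sub>1)
      (qcnj \<zeta>\<^sub>2 * qi * z + qcnj z * qi * \<zeta>\<^sub>2, p\<^sub>2)
    = canonical_form (\<zeta>\<^sub>1, (-2) *\<^sub>R (qi * (\<zeta>\<^sub>1 * P + z * p\<^sub>1)))
      (\<zeta>\<^sub>2, (-2) *\<^sub>R (qi * (\<zeta>\<^sub>2 * P + z * p\<^sub>2)))"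
  using assms by (simp add: canonical_form_def wedge_def algebra_simps)

lemma KS_has_derivative:
  assumes "x \<in> Sigma1"
  obtains D where "(KS has_derivative D) (at x)"
proof -
  have "Ck_on (Suc 0) {x. fst x \<noteq> 0} KS" by (rule Ck_on_KS)
  then have "KS differentiable (at x)"
    using assms unfolding Ck_on.simps mem_Sigma1_iff by blast
  then show thesis using that unfolding differentiable_def by blast
qed

text \<open>Tangent vectors are only given by curves. Differentiating \<open>\<gamma> = (z, -2 i z P)\<close>, where
  \<open>KS \<circ> \<gamma> = (conj z i z, P)\<close>, brings a tangent vector and its image into the shape needed for
  the algebraic identity above.\<close>

lemma KS_curve_derivative:
  assumes \<gamma>: "(\<gamma> has_vector_derivative v) (at 0)" "\<forall>\<^sub>F t in nhds 0. \<gamma> t \<in> Sigma1"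
    and d: "((\<lambda>t. KS (\<gamma> t)) has_vector_derivative d) (at (0::real))"
  defines "z \<equiv> fst (\<gamma> 0)" and "P \<equiv> snd (KS (\<gamma> 0))"
  shows "fst d = qcnj (fst v) * qi * z + qcnj z * qi * fst v"
    and "snd v = (-2) *\<^sub>R (qi * (fst v * P + z * snd d))"
    and "qRe (snd d) = 0" and "qRe P = 0"
proof -
  note fst_v = bounded_linear.has_vector_derivative[OF bounded_linear_fst \<gamma>(1)]
  note snd_v = bounded_linear.has_vector_derivative[OF bounded_linear_snd \<gamma>(1)]
  note fst_d = bounded_linear.has_vector_derivative[OF bounded_linear_fst d]
  note snd_d = bounded_linear.has_vector_derivative[OF bounded_linear_snd d]
  have "((\<lambda>t. fst (KS (\<gamma> t))) has_vector_derivative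
      qcnj (fst v) * qi * z + qcnj z * qi * fst v) (at 0)"
    unfolding fst_KS z_def by (rule has_vector_derivative_hopf[OF fst_v])
  then show "fst d = qcnj (fst v) * qi * z + qcnj z * qi * fst v"
    using fst_d by (rule vector_derivative_unique_at[rotated])
  have "((\<lambda>t. (-2) *\<^sub>R (qi * (fst (\<gamma> t) * snd (KS (\<gamma> t))))) has_vector_derivative
      (-2) *\<^sub>R (qi * (z * snd d + fst v * P))) (at 0)"
    unfolding z_def P_def
    by (rule bounded_linear.has_vector_derivative[OF bounded_linear_scaleR_right
          bounded_linear.has_vector_derivative[OF bounded_linear_mult_right
            has_vector_derivative_mult[OF fst_v snd_d]]])
  moreover have "\<forall>\<^sub>F t in nhds 0. (-2) *\<^sub>R (qi * (fst (\<gamma> t) * snd (KS (\<gamma> t)))) = snd (\<gamma> t)"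
    using \<gamma>(2)
  proof eventually_elim
    case (elim t)
    then have "snd (lift (fst (\<gamma> t)) (snd (KS (\<gamma> t)))) = snd (\<gamma> t)"
      by (simp add: lift_KS mem_Sigma1_iff)
    then show ?case by (simp only: lift_def snd_conv mult.assoc)
  qed
  ultimately have "((\<lambda>t. snd (\<gamma> t)) has_vector_derivative
      (-2) *\<^sub>R (qi * (z * snd d + fst v * P))) (at 0)"
    by (rule has_vector_derivative_eventually_eq)
  then show "snd v = (-2) *\<^sub>R (qi * (fst v * P + z * snd d))"
    using vector_derivative_unique_at[OF snd_v] by (simp only: add.commute)
  have Re: "\<forall>\<^sub>F t in nhds 0. qRe (snd (KS (\<gamma> t))) = 0"
    using \<gamma>(2) by eventually_elim (use KS_in_TIH in \<open>auto simp: TIH_def split_beta\<close>)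
  then show "qRe P = 0"
    unfolding P_def by (rule eventually_nhds_x_imp_x)
  have "((\<lambda>t. qRe (snd (KS (\<gamma> t)))) has_vector_derivative qRe (snd d)) (at 0)"
    by (rule bounded_linear.has_vector_derivative[OF bounded_linear_quat(1) snd_d])
  then have "((\<lambda>t. 0 :: real) has_vector_derivative qRe (snd d)) (at 0)"
    by (rule has_vector_derivative_eventually_eq) (rule Re)
  then show "qRe (snd d) = 0"
    using vector_derivative_unique_at has_vector_derivative_const by blast
qed

lemma canonical_form_KS_curves:
  assumes \<gamma>: "(\<gamma> has_vector_derivative v) (at 0)" "\<forall>\<^sub>F t in nhds 0. \<gamma> t \<in> Sigma1"
    "((\<lambda>t. KS (\<gamma> t)) has_vector_derivative c) (at (0::real))"
    and \<delta>: "(\<delta> has_vector_derivative w) (at 0)" "\<forall>\<^sub>F t in nhds 0. \<delta> t \<in> Sigma1"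
    "((\<lambda>t. KS (\<delta> t)) has_vector_derivative d) (at (0::real))"
    and eq: "\<gamma> 0 = \<delta> 0"
  shows "canonical_form c d = canonical_form v w"
proof -
  note c = KS_curve_derivative[OF \<gamma>] and d = KS_curve_derivative[OF \<delta>, folded eq]
  show ?thesis
    using canonical_form_lift_tangent[OF c(4) c(3) d(3), of "fst v" "fst (\<gamma> 0)" "fst w"]
    by (simp only: c(1,2)[symmetric] d(1,2)[symmetric] prod.collapse)
qed

section \<open>Global charts\<close>

lemma exhaust_6: "x = 1 \<or> x = 2 \<or> x = 3 \<or> x = 4 \<or> x = 5 \<or> x = 6" for x :: 6
proof (induct x)
  case (of_int z)
  then have "z = 0 \<or> z = 1 \<or> z = 2 \<or> z = 3 \<or> z = 4 \<or> z = 5" by fastforce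
  then show ?case by auto
qed

lemma forall_6: "(\<forall>i::6. P i) \<longleftrightarrow> P 1 \<and> P 2 \<and> P 3 \<and> P 4 \<and> P 5 \<and> P 6"
  by (metis exhaust_6)

text \<open>Real coordinates on pairs of imaginary quaternions; they provide a chart of the whole
  cotangent bundle.\<close>

definition from_coords :: "real^6 \<Rightarrow> quat \<times> quat" where
  "from_coords a = (Quat 0 (a$1) (a$2) (a$3), Quat 0 (a$4) (a$5) (a$6))"

definition coords :: "quat \<times> quat \<Rightarrow> real^6" where
  "coords x = (\<chi> i.
     if i = 1 then qIm1 (fst x) else if i = 2 then qIm2 (fst x) else if i = 3 then qIm3 (fst x)
     else if i = 4 then qIm1 (snd x) else if i = 5 then qIm2 (snd x) else qIm3 (snd x))"

lemma coords_from_coords [simp]: "coords (from_coords a) = a"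
  by (simp add: coords_def from_coords_def vec_eq_iff forall_6)

lemma from_coords_coords: "qRe (fst x) = 0 \<Longrightarrow> qRe (snd x) = 0 \<Longrightarrow> from_coords (coords x) = x"
  by (simp add: coords_def from_coords_def prod_eq_iff quat_eq_iff)

lemma qRe_from_coords [simp]: "qRe (fst (from_coords a)) = 0" "qRe (snd (from_coords a)) = 0"
  by (simp_all add: from_coords_def)

lemma bounded_linear_from_coords: "bounded_linear from_coords"
  unfolding linear_conv_bounded_linear[symmetric]
  by (rule linearI; simp add: from_coords_def quat_eq_iff)

lemma bounded_linear_coords: "bounded_linear coords"
  unfolding linear_conv_bounded_linear[symmetric]
  by (rule linearI; simp add: coords_def vec_eq_iff)

lemma from_coords_coords_TIH: "y \<in> TIH \<Longrightarrow> from_coords (coords y) = y"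
  by (auto simp: TIH_def intro!: from_coords_coords)

lemma from_coords_in_TIH_iff: "from_coords a \<in> TIH \<longleftrightarrow> fst (from_coords a) \<noteq> 0"
  using qRe_from_coords[of a] by (auto simp: TIH_def split_beta)

lemma coords_image_TIH: "coords ` TIH = {a. fst (from_coords a) \<noteq> 0}"
proof -
  have "a \<in> coords ` TIH \<longleftrightarrow> from_coords a \<in> TIH" for a
    using from_coords_coords_TIH coords_from_coords by (metis image_iff)
  then show ?thesis by (auto simp: from_coords_in_TIH_iff)
qed

lemma open_coords_image_TIH: "open (coords ` TIH)"
  unfolding coords_image_TIH
  using linear_continuous_on[OF bounded_linear_from_coords]
  by (intro open_Collect_neq continuous_intros)

lemma inj_on_coords_TIH: "inj_on coords TIH"
  by (rule inj_on_inverseI[of _ from_coords]) (rule from_coords_coords_TIH)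

lemma inv_into_coords: "a \<in> coords ` TIH \<Longrightarrow> inv_into TIH coords a = from_coords a"
  using from_coords_coords_TIH inv_into_f_f[OF inj_on_coords_TIH] by force

lemma coords_chart: "(TIH, coords) \<in> TIH_charts"
proof -
  have "smooth_on TIH coords"
    by (rule smooth_onI_open[OF open_UNIV]) (auto intro: Ck_on_linear bounded_linear_coords)
  moreover have "smooth_on (coords ` TIH) (inv_into TIH coords)"
    by (rule smooth_on_cong[OF inv_into_coords[symmetric] smooth_onI_open[OF open_UNIV]])
      (auto intro: Ck_on_linear bounded_linear_from_coords)
  ultimately show ?thesis
    using inj_on_coords_TIH open_coords_image_TIH by (simp add: TIH_charts_def submanifold_charts_def)
qed

text \<open>The choice of a representative is immaterial by \<open>orbit_eq_iff_KS_eq\<close>.\<close>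

definition KS_quotient :: "(quat \<times> quat) set \<Rightarrow> quat \<times> quat" where
  "KS_quotient p = KS (inv_into Sigma1 orbit p)"

lemma KS_quotient_orbit [simp]:
  assumes "x \<in> Sigma1"
  shows "KS_quotient (orbit x) = KS x"
  using orbit_eq_iff_KS_eq[of "inv_into Sigma1 orbit (orbit x)" x] assms
  by (simp add: KS_quotient_def inv_into_into f_inv_into_f)

lemma bij_betw_KS_quotient: "bij_betw KS_quotient V1 TIH"
proof -
  have "KS_quotient ` V1 = KS ` Sigma1"
    unfolding V1_def image_image by simp
  moreover have "inj_on KS_quotient V1"
    by (auto simp: inj_on_def V1_def orbit_eq_iff_KS_eq)
  ultimately show ?thesis by (simp add: bij_betw_def KS_image_Sigma1)
qed

text \<open>With this \<open>\<zeta>\<close> the term \<open>conj z i \<zeta>\<close> equals \<open>q/2\<close>, and the other term is minus its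
  conjugate, hence also \<open>q/2\<close>.\<close>

lemma hopf_derivative_right_inverse:
  assumes "z \<noteq> 0" "qRe q = 0"
  defines "\<zeta> \<equiv> (- 1 / (2 * (norm z)\<^sup>2)) *\<^sub>R (qi * z * q)"
  shows "qcnj \<zeta> * qi * z + qcnj z * qi * \<zeta> = q"
proof -
  have "qcnj z * qi * (qi * z * q) = qcnj z * (qi * qi) * z * q"
    by (simp only: mult.assoc)
  also have "\<dots> = - ((norm z)\<^sup>2 *\<^sub>R q)"
    by (simp add: qi_mult_qi qcnj_mult_self)
  finally have half: "qcnj z * qi * \<zeta> = (1 / 2) *\<^sub>R q"
    using assms(1) by (simp add: \<zeta>_def)
  have "qcnj \<zeta> * qi * z = - qcnj (qcnj z * qi * \<zeta>)"
    by (simp add: quat_eq_iff algebra_simps)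
  also have "\<dots> = (1 / 2) *\<^sub>R q"
    unfolding half using assms(2) by (simp add: quat_eq_iff)
  finally show ?thesis
    unfolding half by (simp add: scaleR_left_distrib[symmetric])
qed

text \<open>The map is a submersion: in the coordinates \<open>(z, P)\<close>, a line whose \<open>z\<close>-direction is a
  preimage under the derivative of the Hopf map realizes any prescribed velocity of the image curve.\<close>

lemma KS_lifts_tangent_vectors:
  assumes x: "x \<in> Sigma1"
  obtains \<gamma> v where "v \<in> tangent_space Sigma1 x" "\<gamma> 0 = x" "\<forall>\<^sub>F t in nhds 0. \<gamma> t \<in> Sigma1"
    "(\<gamma> has_vector_derivative v) (at 0)" "((\<lambda>t. KS (\<gamma> t)) has_vector_derivative from_coords u) (at (0::real))"
proof -
  define z where "z = fst x"
  define P where "P = snd (KS x)"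
  define q where "q = fst (from_coords u)"
  define p where "p = snd (from_coords u)"
  define \<zeta> where "\<zeta> = (- 1 / (2 * (norm z)\<^sup>2)) *\<^sub>R (qi * z * q)"
  have z: "z \<noteq> 0" using x by (simp add: z_def mem_Sigma1_iff)
  have P: "qRe P = 0" using KS_in_TIH[OF x] by (auto simp: P_def TIH_def split_beta)
  have qp: "qRe q = 0" "qRe p = 0" by (simp_all add: q_def p_def)
  define f where "f = (\<lambda>t::real. z + t *\<^sub>R \<zeta>)"
  define g where "g = (\<lambda>t::real. P + t *\<^sub>R p)"
  define \<gamma> where "\<gamma> = (\<lambda>t. lift (f t) (g t))"
  have Ck_affine: "Ck_on k UNIV (\<lambda>t::real. a + t *\<^sub>R b)" for k and a b :: quat
    by (rule Ck_on_add[OF open_UNIV Ck_on_const[OF open_UNIV]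
          Ck_on_linear[OF bounded_linear_scaleR_left open_UNIV]])
  have Ck: "Ck_on k UNIV \<gamma>" for k
    unfolding \<gamma>_def lift_def f_def g_def
    by (rule Ck_on_Pair[OF open_UNIV Ck_affine
          Ck_on_linear_compose[OF bounded_linear_scaleR_right open_UNIV
            Ck_on_bilinear[OF bounded_bilinear_mult open_UNIV
              Ck_on_linear_compose[OF bounded_linear_mult_right open_UNIV Ck_affine] Ck_affine]]])
  have \<gamma>0: "\<gamma> 0 = x"
    using lift_KS[of x] z by (simp add: \<gamma>_def f_def g_def z_def P_def)
  have "Ck_on (Suc 0) UNIV \<gamma>" by (rule Ck)
  then have "\<gamma> differentiable (at 0)" by simp
  then obtain v where v: "(\<gamma> has_vector_derivative v) (at 0)"
    using vector_derivative_works by blast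
  have "open {t. f t \<noteq> 0}"
    unfolding f_def by (intro open_Collect_neq continuous_intros)
  moreover have "0 \<in> {t. f t \<noteq> 0}" using z by (simp add: f_def)
  ultimately obtain e where e: "e > 0" "\<And>t. dist t 0 < e \<Longrightarrow> f t \<noteq> 0"
    unfolding open_dist by blast
  have in_S: "\<gamma> t \<in> Sigma1" if "f t \<noteq> 0" for t
    unfolding \<gamma>_def using that P qp by (intro lift_in_Sigma1) (simp_all add: g_def)
  have "smooth_on {-e<..<e} \<gamma>"
    by (rule smooth_onI_open[OF open_UNIV _ Ck]) simp
  moreover have "\<gamma> ` {-e<..<e} \<subseteq> Sigma1"
    using e(2) in_S by (auto simp: dist_real_def)
  ultimately have "v \<in> tangent_space Sigma1 x"
    unfolding tangent_space_def using e(1) \<gamma>0 v by blast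
  have ev: "\<forall>\<^sub>F t in nhds 0. f t \<noteq> 0"
    unfolding eventually_nhds_metric using e by blast
  have "\<forall>\<^sub>F t in nhds 0. \<gamma> t \<in> Sigma1"
    using ev by eventually_elim (rule in_S)
  have f: "(f has_vector_derivative \<zeta>) (at 0)" and g: "(g has_vector_derivative p) (at 0)"
    unfolding f_def g_def by (auto intro!: derivative_eq_intros)
  have "((\<lambda>t. (qcnj (f t) * qi * f t, g t)) has_vector_derivative (q, p)) (at 0)"
    using has_vector_derivative_Pair[OF has_vector_derivative_hopf[OF f] g]
      hopf_derivative_right_inverse[OF z qp(1), folded \<zeta>_def]
    by (simp add: f_def)
  moreover have "\<forall>\<^sub>F t in nhds 0. (qcnj (f t) * qi * f t, g t) = KS (\<gamma> t)"
    using ev by eventually_elim (simp add: \<gamma>_def KS_lift)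
  ultimately have "((\<lambda>t. KS (\<gamma> t)) has_vector_derivative from_coords u) (at 0)"
    unfolding q_def p_def prod.collapse by (rule has_vector_derivative_eventually_eq)
  then show thesis
    using that \<open>v \<in> tangent_space Sigma1 x\<close> \<gamma>0 \<open>\<forall>\<^sub>F t in nhds 0. \<gamma> t \<in> Sigma1\<close> v by blast
qed

text \<open>The induced map turns the global chart of the target into a global chart of the
  quotient. This makes it a diffeomorphism, since both it and its inverse become the identity in these
  charts.\<close>

lemma coords_KS_quotient_chart: "(V1, coords \<circ> KS_quotient) \<in> V1_charts"
proof -
  have sat: "Sigma1 \<inter> orbit -` V1 = Sigma1" by (auto simp: V1_def)
  have img: "KS_quotient ` V1 = TIH" and inj: "inj_on KS_quotient V1"
    using bij_betw_KS_quotient by (simp_all add: bij_betw_def)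
  have eq: "(coords \<circ> KS_quotient \<circ> orbit) x = coords (KS x)" if "x \<in> Sigma1" for x
    using that by simp
  have "smooth_on Sigma1 (\<lambda>x. coords (KS x))"
  proof (rule smooth_onI_open)
    show "open {x :: quat \<times> quat. fst x \<noteq> 0}"
      by (intro open_Collect_neq continuous_intros)
    then show "Ck_on k {x. fst x \<noteq> 0} (\<lambda>x. coords (KS x))" for k
      by (rule Ck_on_linear_compose[OF bounded_linear_coords _ Ck_on_KS])
  qed (auto simp: mem_Sigma1_iff)
  then have "smooth_on Sigma1 (coords \<circ> KS_quotient \<circ> orbit)"
    by (rule smooth_on_cong[rotated]) (simp only: eq)
  moreover have "D ` tangent_space Sigma1 x = UNIV"
    if x: "x \<in> Sigma1" and D: "((coords \<circ> KS_quotient \<circ> orbit) has_derivative D) (at x within Sigma1)" for x D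
  proof -
    have "u \<in> D ` tangent_space Sigma1 x" for u
    proof -
      obtain \<gamma> v where \<gamma>: "v \<in> tangent_space Sigma1 x" "\<gamma> 0 = x" "\<forall>\<^sub>F t in nhds 0. \<gamma> t \<in> Sigma1"
        "(\<gamma> has_vector_derivative v) (at 0)"
        "((\<lambda>t. KS (\<gamma> t)) has_vector_derivative from_coords u) (at (0::real))"
        by (rule KS_lifts_tangent_vectors[OF x])
      have "((\<lambda>t. (coords \<circ> KS_quotient \<circ> orbit) (\<gamma> t)) has_vector_derivative D v) (at 0)"
        by (rule has_vector_derivative_along_curve[OF \<gamma>(4,3)]) (simp only: \<gamma>(2) D)
      moreover have "\<forall>\<^sub>F t in nhds 0. (coords \<circ> KS_quotient \<circ> orbit) (\<gamma> t) = coords (KS (\<gamma> t))"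
        using \<gamma>(3) by eventually_elim (rule eq)
      ultimately have "((\<lambda>t. coords (KS (\<gamma> t))) has_vector_derivative D v) (at 0)"
        by (rule has_vector_derivative_eventually_eq)
      moreover have "((\<lambda>t. coords (KS (\<gamma> t))) has_vector_derivative coords (from_coords u)) (at 0)"
        by (rule bounded_linear.has_vector_derivative[OF bounded_linear_coords \<gamma>(5)])
      ultimately have "D v = u"
        using vector_derivative_unique_at by fastforce
      then show ?thesis using \<gamma>(1) by blast
    qed
    then show ?thesis by blast
  qed
  moreover have "open ((coords \<circ> KS_quotient) ` V1)"
    unfolding image_comp[symmetric] img by (rule open_coords_image_TIH)
  moreover have "inj_on (coords \<circ> KS_quotient) V1"
    by (rule comp_inj_on[OF inj]) (simp only: img inj_on_coords_TIH)
  moreover have "V1 \<subseteq> orbit ` Sigma1"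
    by (simp add: V1_def)
  ultimately show ?thesis
    unfolding V1_charts_def quotient_charts_def mem_Collect_eq prod.case sat
    using openin_subtopology_self by blast
qed

section \<open>The induced map in an arbitrary chart\<close>

text \<open>The symplectic condition refers to every chart \<open>\<phi>\<close> of the quotient, so the induced map has to be
  differentiated in an arbitrary one. Composing \<open>\<phi> \<circ> orbit\<close> with a local section \<open>\<sigma>\<close> of
  the Kustaanheimo--Stiefel map gives a map \<open>H\<close> between open sets of the model space, and the
  induced map inverts it. The derivative \<open>D \<circ> \<sigma>'\<close> of \<open>H\<close> is surjective because \<open>D\<close> is:
  a curve in \<open>\<Sigma>\<^sup>1\<close> can be moved along the circle orbits into the image of \<open>\<sigma>\<close>, which does not
  change its image in the quotient. Since \<open>H\<close> is continuous and injective
  and its derivative at one point is invertible, its inverse is differentiable at the image of that point.\<close>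

lemma quotient_chart_compose_KS_quotient_inverse:
  assumes chart: "(U, \<phi>) \<in> V1_charts" and x: "x \<in> Sigma1" "orbit x \<in> U"
    and D: "((\<phi> \<circ> orbit) has_derivative D) (at x within Sigma1)"
  obtains G where "(KS_quotient \<circ> inv_into U \<phi> has_derivative G) (at (\<phi> (orbit x)))"
proof -
  let ?S = "Sigma1 \<inter> orbit -` U"
  have op: "openin (top_of_set Sigma1) ?S" and inj: "inj_on \<phi> U" and opi: "open (\<phi> ` U)"
    and sm: "smooth_on ?S (\<phi> \<circ> orbit)" and U: "U \<subseteq> V1"
    and surj: "D ` tangent_space Sigma1 x = UNIV"
    using chart x D by (auto simp: V1_charts_def quotient_charts_def V1_def)
  obtain T where T: "open T" "?S = Sigma1 \<inter> T"
    using op by (auto simp: openin_open)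
  define z where "z = fst x"
  have z: "z \<noteq> 0" using x by (simp add: z_def mem_Sigma1_iff)
  obtain N\<^sub>1 s where s: "open N\<^sub>1" "qcnj z * qi * z \<in> N\<^sub>1" "s (qcnj z * qi * z) = z"
    "continuous_on N\<^sub>1 s" "s differentiable (at (qcnj z * qi * z))"
    "\<And>Q. Q \<in> N\<^sub>1 \<Longrightarrow> qRe Q = 0 \<Longrightarrow> s Q \<noteq> 0 \<and> qcnj (s Q) * qi * s Q = Q"
    by (rule local_hopf_section[OF z]) blast
  define \<sigma> where "\<sigma> = (\<lambda>a. lift (s (fst (from_coords a))) (snd (from_coords a)))"
  define a\<^sub>0 where "a\<^sub>0 = coords (KS x)"
  have from_coords_a\<^sub>0: "from_coords a\<^sub>0 = KS x"
    unfolding a\<^sub>0_def by (rule from_coords_coords_TIH[OF KS_in_TIH[OF x(1)]])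
  then have fst_a\<^sub>0: "fst (from_coords a\<^sub>0) = qcnj z * qi * z"
    by (simp add: fst_KS z_def)
  define W where "W = {a. fst (from_coords a) \<in> N\<^sub>1}"
  have lin_fst: "bounded_linear (\<lambda>a. fst (from_coords a))" and lin_snd: "bounded_linear (\<lambda>a. snd (from_coords a))"
    using bounded_linear_compose[OF bounded_linear_fst bounded_linear_from_coords]
      bounded_linear_compose[OF bounded_linear_snd bounded_linear_from_coords] by simp_all
  have "open W"
    unfolding W_def using open_vimage[OF s(1) linear_continuous_on[OF lin_fst]]
    by (simp add: vimage_def)
  have "a\<^sub>0 \<in> W" using s(2) by (simp add: W_def fst_a\<^sub>0)
  have \<sigma>_S: "\<sigma> a \<in> Sigma1" and KS_\<sigma>: "KS (\<sigma> a) = from_coords a" if "a \<in> W" for a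
    using that s(6)[of "fst (from_coords a)"]
    by (simp_all add: \<sigma>_def W_def lift_in_Sigma1 KS_lift)
  have \<sigma>_a\<^sub>0: "\<sigma> a\<^sub>0 = x"
    using lift_KS[of x] z by (simp add: \<sigma>_def fst_a\<^sub>0 s(3)) (simp add: z_def from_coords_a\<^sub>0)
  have cont_\<sigma>: "continuous_on W \<sigma>"
  proof -
    have "continuous_on W (\<lambda>a. s (fst (from_coords a)))"
      by (rule continuous_on_compose2[OF s(4) linear_continuous_on[OF lin_fst]]) (auto simp: W_def)
    then show ?thesis
      unfolding \<sigma>_def lift_def
      by (intro continuous_on_Pair continuous_on_scaleR continuous_on_mult continuous_on_const
          linear_continuous_on[OF lin_snd])
  qed
  obtain \<sigma>' where \<sigma>': "(\<sigma> has_derivative \<sigma>') (at a\<^sub>0)"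
  proof -
    have "(\<lambda>a. s (fst (from_coords a))) differentiable (at a\<^sub>0)"
      using differentiable_chain_at[OF bounded_linear_imp_differentiable[OF lin_fst], of s a\<^sub>0] s(5)
      by (simp add: fst_a\<^sub>0 o_def)
    then obtain s' where s': "((\<lambda>a. s (fst (from_coords a))) has_derivative s') (at a\<^sub>0)"
      unfolding differentiable_def by blast
    show thesis
      by (rule that, unfold \<sigma>_def lift_def)
        (rule has_derivative_Pair[OF s' has_derivative_scaleR_right[OF
              has_derivative_mult[OF has_derivative_mult_right[OF s']
                bounded_linear_imp_has_derivative[OF lin_snd]]]])
  qed
  define N where "N = W \<inter> \<sigma> -` T"
  have "open N"
    unfolding N_def by (rule continuous_open_preimage[OF cont_\<sigma> \<open>open W\<close> T(1)])
  have \<sigma>_N: "\<sigma> a \<in> ?S" if "a \<in> N" for a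
    using that \<sigma>_S unfolding T(2) by (auto simp: N_def)
  have "x \<in> ?S" using x by simp
  then have "a\<^sub>0 \<in> N"
    using \<open>a\<^sub>0 \<in> W\<close> by (simp add: N_def \<sigma>_a\<^sub>0 T(2))
  define H where "H = (\<lambda>a. (\<phi> \<circ> orbit) (\<sigma> a))"
  have cont_H: "continuous_on N H"
    unfolding H_def
  proof (rule continuous_on_compose2[OF smooth_on_imp_continuous_on[OF sm]])
    show "continuous_on N \<sigma>"
      by (rule continuous_on_subset[OF cont_\<sigma>]) (simp add: N_def)
    show "\<sigma> ` N \<subseteq> ?S" using \<sigma>_N by blast
  qed
  have H': "(H has_derivative D \<circ> \<sigma>') (at a\<^sub>0)"
  proof -
    have "((\<phi> \<circ> orbit \<circ> \<sigma>) has_derivative D \<circ> \<sigma>') (at a\<^sub>0 within N)"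
    proof (rule diff_chain_within)
      show "(\<sigma> has_derivative \<sigma>') (at a\<^sub>0 within N)" by (rule has_derivative_at_withinI[OF \<sigma>'])
      show "((\<phi> \<circ> orbit) has_derivative D) (at (\<sigma> a\<^sub>0) within \<sigma> ` N)"
        unfolding \<sigma>_a\<^sub>0 by (rule has_derivative_subset[OF D]) (use \<sigma>_N in blast)
    qed
    then show ?thesis
      unfolding at_within_open[OF \<open>a\<^sub>0 \<in> N\<close> \<open>open N\<close>] by (simp add: H_def o_def)
  qed
  \<comment> \<open>If \<open>u\<close> is the velocity of \<open>\<phi> \<circ> orbit \<circ> \<gamma>\<close>, then it is also the velocity of \<open>H \<circ> c\<close>, where
    \<open>c\<close> is the image of \<open>\<gamma>\<close> under the Kustaanheimo--Stiefel map.\<close>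
  have "u \<in> range (D \<circ> \<sigma>')" for u
  proof -
    obtain v where v: "v \<in> tangent_space Sigma1 x" "D v = u"
      using surj by (metis UNIV_I imageE)
    obtain \<gamma> where \<gamma>: "\<forall>\<^sub>F t in nhds (0::real). \<gamma> t \<in> Sigma1" "\<gamma> 0 = x"
      "(\<gamma> has_vector_derivative v) (at 0)"
      by (rule tangent_spaceE[OF v(1)])
    obtain K where K: "(KS has_derivative K) (at x)"
      by (rule KS_has_derivative[OF x(1)])
    define c where "c = (\<lambda>t. coords (KS (\<gamma> t)))"
    have c: "(c has_vector_derivative coords (K v)) (at 0)"
      unfolding c_def
      by (rule bounded_linear.has_vector_derivative[OF bounded_linear_coords])
        (rule has_vector_derivative_along_curve[OF \<gamma>(3), of UNIV], use K \<gamma>(2) in auto)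
    have c0: "c 0 = a\<^sub>0" by (simp add: c_def \<gamma>(2) a\<^sub>0_def)
    have "continuous (at 0) c"
      using c has_vector_derivative_continuous by blast
    then have "\<forall>\<^sub>F t in nhds 0. c t \<in> W"
      using \<open>open W\<close> \<open>a\<^sub>0 \<in> W\<close> unfolding continuous_at_open c0[symmetric] eventually_nhds by blast
    then have "\<forall>\<^sub>F t in nhds 0. H (c t) = (\<phi> \<circ> orbit) (\<gamma> t)"
      using \<gamma>(1)
    proof eventually_elim
      case (elim t)
      have "KS (\<sigma> (c t)) = KS (\<gamma> t)"
        using KS_\<sigma>[OF elim(1)] from_coords_coords_TIH[OF KS_in_TIH[OF elim(2)]] by (simp add: c_def)
      then have "orbit (\<sigma> (c t)) = orbit (\<gamma> t)"
        using orbit_eq_iff_KS_eq \<sigma>_S elim by blast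
      then show ?case by (simp add: H_def)
    qed
    moreover have "((\<lambda>t. H (c t)) has_vector_derivative (D \<circ> \<sigma>') (coords (K v))) (at 0)"
    proof (rule has_vector_derivative_along_curve[OF c])
      show "(H has_derivative D \<circ> \<sigma>') (at (c 0))" unfolding c0 by (rule H')
    qed simp
    ultimately have "((\<lambda>t. (\<phi> \<circ> orbit) (\<gamma> t)) has_vector_derivative (D \<circ> \<sigma>') (coords (K v))) (at 0)"
      by (rule has_vector_derivative_eventually_eq[rotated])
    moreover have "((\<lambda>t. (\<phi> \<circ> orbit) (\<gamma> t)) has_vector_derivative D v) (at 0)"
      by (rule has_vector_derivative_along_curve[OF \<gamma>(3,1)]) (simp only: \<gamma>(2) D)
    ultimately have "(D \<circ> \<sigma>') (coords (K v)) = u"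
      using vector_derivative_unique_at v(2) by blast
    then show ?thesis by blast
  qed
  then have "surj (D \<circ> \<sigma>')" by blast
  moreover have "linear (D \<circ> \<sigma>')"
    using H' by (rule has_derivative_linear)
  ultimately obtain g where g: "(D \<circ> \<sigma>') \<circ> g = id"
    using linear_surjective_right_inverse by blast
  have "((\<lambda>y. coords (KS_quotient (inv_into U \<phi> y))) has_derivative g) (at (H a\<^sub>0))"
  proof (rule has_derivative_inverse_strong[OF \<open>open N\<close> \<open>a\<^sub>0 \<in> N\<close> cont_H _ H' g])
    fix a assume a: "a \<in> N"
    then have "orbit (\<sigma> a) \<in> U" "\<sigma> a \<in> Sigma1" "a \<in> W" using \<sigma>_N by (auto simp: N_def)
    then show "coords (KS_quotient (inv_into U \<phi> (H a))) = a"
      by (simp add: H_def inv_into_f_f[OF inj] KS_\<sigma>)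
  qed
  then have "((\<lambda>y. coords (KS_quotient (inv_into U \<phi> y))) has_derivative g) (at (\<phi> (orbit x)))"
    by (simp add: H_def \<sigma>_a\<^sub>0)
  from bounded_linear.has_derivative[OF bounded_linear_from_coords this]
  have "(KS_quotient \<circ> inv_into U \<phi> has_derivative (\<lambda>v. from_coords (g v))) (at (\<phi> (orbit x)))"
  proof (rule has_derivative_transform_within_open[OF _ opi])
    show "\<phi> (orbit x) \<in> \<phi> ` U" using x(2) by (rule imageI)
    fix y assume "y \<in> \<phi> ` U"
    then have "KS_quotient (inv_into U \<phi> y) \<in> TIH"
      by (intro bij_betw_apply[OF bij_betw_KS_quotient] subsetD[OF U] inv_into_into)
    then show "from_coords (coords (KS_quotient (inv_into U \<phi> y))) = (KS_quotient \<circ> inv_into U \<phi>) y"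
      by (simp add: from_coords_coords_TIH)
  qed
  then show thesis by (rule that)
qed

text \<open>The derivative of the induced map in the chart \<open>\<phi>\<close> takes \<open>D v\<close> to the
  image of \<open>v\<close> under the differential of the Kustaanheimo--Stiefel map. This chain rule is stated along curves,
  as tangent vectors of \<open>\<Sigma>\<^sup>1\<close> are velocities of curves.\<close>

lemma KS_quotient_inverse_along_curve:
  assumes inj: "inj_on \<phi> U" and U: "openin (top_of_set Sigma1) (Sigma1 \<inter> orbit -` U)"
    and x: "x \<in> Sigma1" "orbit x \<in> U"
    and D: "((\<phi> \<circ> orbit) has_derivative D) (at x within Sigma1)"
    and G: "(KS_quotient \<circ> inv_into U \<phi> has_derivative G) (at (\<phi> (orbit x)))"
    and \<gamma>: "\<forall>\<^sub>F t in nhds 0. \<gamma> t \<in> Sigma1" "\<gamma> 0 = x" "(\<gamma> has_vector_derivative v) (at (0::real))"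
  shows "((\<lambda>t. KS (\<gamma> t)) has_vector_derivative G (D v)) (at 0)"
proof -
  obtain T where T: "open T" "Sigma1 \<inter> orbit -` U = Sigma1 \<inter> T"
    using U by (auto simp: openin_open)
  have "continuous (at 0) \<gamma>"
    using \<gamma>(3) has_vector_derivative_continuous by blast
  moreover have "x \<in> T" using T(2) x by blast
  ultimately have "\<forall>\<^sub>F t in nhds 0. \<gamma> t \<in> T"
    using T(1) unfolding continuous_at_open \<gamma>(2)[symmetric] eventually_nhds by blast
  then have eq: "\<forall>\<^sub>F t in nhds 0. (KS_quotient \<circ> inv_into U \<phi>) ((\<phi> \<circ> orbit) (\<gamma> t)) = KS (\<gamma> t)"
    using \<gamma>(1)
  proof eventually_elim
    case (elim t)
    then have "orbit (\<gamma> t) \<in> U" using T(2) by blast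
    then show ?case using elim(2) by (simp add: inv_into_f_f[OF inj])
  qed
  have "((\<lambda>t. (\<phi> \<circ> orbit) (\<gamma> t)) has_vector_derivative D v) (at 0)"
    by (rule has_vector_derivative_along_curve[OF \<gamma>(3,1)]) (simp only: \<gamma>(2) D)
  then have "((\<lambda>t. (KS_quotient \<circ> inv_into U \<phi>) ((\<phi> \<circ> orbit) (\<gamma> t))) has_vector_derivative G (D v)) (at 0)"
    by (rule has_vector_derivative_along_curve[where S = UNIV])
      (use G \<gamma>(2) in \<open>simp_all del: o_apply add: o_apply[of \<phi> orbit]\<close>)
  then show ?thesis
    by (rule has_vector_derivative_eventually_eq[OF _ eq])
qed

text \<open>The pull-back of the canonical form by the induced map, written in a chart of the
  quotient. It shows that a reduced form exists, which the definition of \<open>omega1\<close> by choice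
  presupposes.\<close>

definition KS_pullback :: "((quat \<times> quat) set, real^6) form2" where
  "KS_pullback = (\<lambda>(U, \<phi>) y u v.
     canonical_form (frechet_derivative (KS_quotient \<circ> inv_into U \<phi>) (at y) u)
       (frechet_derivative (KS_quotient \<circ> inv_into U \<phi>) (at y) v))"

lemma reduced_form_KS_pullback: "reduced_form Sigma1 orbit canonical_form KS_pullback"
proof -
  have "KS_pullback (U, \<phi>) (\<phi> (orbit x)) (D \<xi>) (D \<eta>) = canonical_form \<xi> \<eta>"
    if chart: "(U, \<phi>) \<in> V1_charts" and x: "x \<in> Sigma1" "orbit x \<in> U"
      and D: "((\<phi> \<circ> orbit) has_derivative D) (at x within Sigma1)"
      and \<xi>: "\<xi> \<in> tangent_space Sigma1 x" and \<eta>: "\<eta> \<in> tangent_space Sigma1 x"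
    for U \<phi> x D \<xi> \<eta>
  proof -
    have inj: "inj_on \<phi> U" and op: "openin (top_of_set Sigma1) (Sigma1 \<inter> orbit -` U)"
      using chart by (simp_all add: V1_charts_def quotient_charts_def)
    obtain G where G: "(KS_quotient \<circ> inv_into U \<phi> has_derivative G) (at (\<phi> (orbit x)))"
      by (rule quotient_chart_compose_KS_quotient_inverse[OF chart x D])
    obtain \<gamma> where \<gamma>: "\<forall>\<^sub>F t in nhds (0::real). \<gamma> t \<in> Sigma1" "\<gamma> 0 = x"
      "(\<gamma> has_vector_derivative \<xi>) (at 0)"
      by (rule tangent_spaceE[OF \<xi>])
    obtain \<delta> where \<delta>: "\<forall>\<^sub>F t in nhds (0::real). \<delta> t \<in> Sigma1" "\<delta> 0 = x"
      "(\<delta> has_vector_derivative \<eta>) (at 0)"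
      by (rule tangent_spaceE[OF \<eta>])
    note along = KS_quotient_inverse_along_curve[OF inj op x D G]
    have "canonical_form (G (D \<xi>)) (G (D \<eta>)) = canonical_form \<xi> \<eta>"
      by (rule canonical_form_KS_curves[OF \<gamma>(3,1) along[OF \<gamma>] \<delta>(3,1) along[OF \<delta>]])
        (simp only: \<gamma>(2) \<delta>(2))
    then show ?thesis
      by (simp only: KS_pullback_def prod.case frechet_derivative_at[OF G, symmetric])
  qed
  then show ?thesis
    unfolding reduced_form_def V1_charts_def by blast
qed

lemma reduced_form_omega1: "reduced_form Sigma1 orbit canonical_form omega1"
  unfolding omega1_def using reduced_form_KS_pullback
  by (rule someI[where P = "reduced_form Sigma1 orbit canonical_form"])

text \<open>In a chart, two reduced forms can only differ at points outside its image: at a point of the image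
  every vector is \<open>D \<xi>\<close> for a tangent vector \<open>\<xi>\<close>.\<close>

lemma reduced_form_unique:
  assumes \<omega>: "reduced_form S \<pi> \<Omega> \<omega>" and \<eta>: "reduced_form S \<pi> \<Omega> \<eta>"
    and chart: "(U, \<phi>) \<in> quotient_charts S \<pi>" and x: "x \<in> S" "\<pi> x \<in> U"
    and D: "((\<phi> \<circ> \<pi>) has_derivative D) (at x within S)"
  shows "\<omega> (U, \<phi>) (\<phi> (\<pi> x)) = \<eta> (U, \<phi>) (\<phi> (\<pi> x))"
proof (intro ext)
  fix u v
  have "D ` tangent_space S x = UNIV"
    using chart x D unfolding quotient_charts_def by blast
  then obtain \<xi> \<zeta> where \<xi>: "\<xi> \<in> tangent_space S x" "D \<xi> = u" and \<zeta>: "\<zeta> \<in> tangent_space S x" "D \<zeta> = v"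
    by (metis UNIV_I imageE)
  have *: "\<theta> (U, \<phi>) (\<phi> (\<pi> x)) (D \<xi>) (D \<zeta>) = \<Omega> \<xi> \<zeta>" if "reduced_form S \<pi> \<Omega> \<theta>" for \<theta>
    using that chart x D \<xi>(1) \<zeta>(1) unfolding reduced_form_def by blast
  show "\<omega> (U, \<phi>) (\<phi> (\<pi> x)) u v = \<eta> (U, \<phi>) (\<phi> (\<pi> x)) u v"
    using *[OF \<omega>] *[OF \<eta>] by (simp add: \<xi>(2) \<zeta>(2))
qed

lemma quotient_chart_has_derivative:
  assumes "(U, \<phi>) \<in> quotient_charts S \<pi>" "x \<in> S" "\<pi> x \<in> U"
  obtains D where "((\<phi> \<circ> \<pi>) has_derivative D) (at x within S)"
proof -
  have sm: "smooth_on (S \<inter> \<pi> -` U) (\<phi> \<circ> \<pi>)" and op: "openin (top_of_set S) (S \<inter> \<pi> -` U)"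
    using assms(1) by (simp_all add: quotient_charts_def)
  obtain T where T: "open T" "S \<inter> \<pi> -` U = S \<inter> T"
    using op by (auto simp: openin_open)
  have x: "x \<in> S \<inter> \<pi> -` U" using assms by simp
  obtain W g D where g: "open W" "x \<in> W" "(g has_derivative D) (at x)"
    "\<And>y. y \<in> S \<inter> \<pi> -` U \<Longrightarrow> y \<in> W \<Longrightarrow> g y = (\<phi> \<circ> \<pi>) y"
    by (rule smooth_on_local_extension[OF sm x]) blast
  have "((\<phi> \<circ> \<pi>) has_derivative D) (at x within S)"
    by (rule has_derivative_within_agree[OF g(3), of "W \<inter> T"]) (use g T x in auto)
  then show thesis by (rule that)
qed

section \<open>Forms and smooth maps in charts\<close>

text \<open>The inverse of the chart \<open>\<psi>\<close> undoes \<open>\<psi>\<close>, so by the chain rule the chart cancels and only the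
  derivative of \<open>f\<close> into the ambient space remains.\<close>

lemma restrict_form_pullback:
  fixes f :: "'m::euclidean_space \<Rightarrow> 'a::euclidean_space"
  assumes chart: "(V, \<psi>) \<in> submanifold_charts S"
    and f: "(f has_derivative f') (at y)" "f y \<in> V"
    and A: "open A" "y \<in> A" "f ` A \<subseteq> S"
  defines "D \<equiv> frechet_derivative (\<psi> \<circ> f) (at y)"
  shows "restrict_form \<Omega> (V, \<psi>) (\<psi> (f y)) (D u) (D v) = \<Omega> (f' u) (f' v)"
proof -
  have inj: "inj_on \<psi> V" and op: "openin (top_of_set S) V" and opi: "open (\<psi> ` V)"
    and sm: "smooth_on V \<psi>" and smi: "smooth_on (\<psi> ` V) (inv_into V \<psi>)"
    using chart by (simp_all add: submanifold_charts_def)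
  obtain T where T: "open T" "V = S \<inter> T"
    using op by (auto simp: openin_open)
  obtain B where B: "open B" "y \<in> B" "\<And>t. t \<in> B \<Longrightarrow> f t \<in> V"
  proof -
    have "f y \<in> T" using f(2) T(2) by blast
    then obtain B where "open B" "y \<in> B" "\<forall>t\<in>B. f t \<in> T"
      using has_derivative_continuous[OF f(1)] T(1) unfolding continuous_at_open by blast
    then show thesis using that[of "A \<inter> B"] A T(2) by blast
  qed
  obtain \<psi>' where \<psi>': "(\<psi> has_derivative \<psi>') (at (f y) within V)"
    by (rule smooth_on_imp_has_derivative[OF sm f(2)])
  have "((\<psi> \<circ> f) has_derivative \<psi>' \<circ> f') (at y within B)"
    by (rule diff_chain_within[OF has_derivative_at_withinI[OF f(1)] has_derivative_subset[OF \<psi>']])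
      (use B(3) in blast)
  then have 1: "((\<psi> \<circ> f) has_derivative D) (at y)"
    unfolding at_within_open[OF B(2,1)] D_def
    using frechet_derivative_at by metis
  have "\<psi> (f y) \<in> \<psi> ` V" using f(2) by blast
  from smooth_on_imp_has_derivative[OF smi this]
  obtain I where "(inv_into V \<psi> has_derivative I) (at (\<psi> (f y)) within \<psi> ` V)" .
  then have I: "(inv_into V \<psi> has_derivative I) (at (\<psi> (f y)))"
    unfolding at_within_open[OF \<open>\<psi> (f y) \<in> \<psi> ` V\<close> opi] .
  have "((inv_into V \<psi> \<circ> (\<psi> \<circ> f)) has_derivative I \<circ> D) (at y)"
    by (rule diff_chain_at[OF 1]) (simp add: I)
  then have "(f has_derivative I \<circ> D) (at y)"
    by (rule has_derivative_transform_within_open[OF _ B(1,2)])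
      (simp add: inv_into_f_f[OF inj] B(3))
  then have "I \<circ> D = f'"
    using f(1) by (rule has_derivative_unique)
  then have "I (D w) = f' w" for w by (metis o_apply)
  then show ?thesis
    by (simp add: restrict_form_def frechet_derivative_at[OF I, symmetric])
qed

text \<open>The expression of \<open>F\<close> in these charts is the identity.\<close>

lemma smooth_map_global_charts:
  fixes \<phi> :: "'m \<Rightarrow> 'e::euclidean_space" and \<psi> :: "'n \<Rightarrow> 'e"
  assumes "(M, \<phi>) \<in> A" "(N, \<psi>) \<in> B" "F ` M \<subseteq> N"
    and eq: "\<And>p. p \<in> M \<Longrightarrow> \<psi> (F p) = \<phi> p"
  shows "smooth_map M A B F"
proof -
  have "smooth_on (\<phi> ` M) (\<psi> \<circ> F \<circ> inv_into M \<phi>)"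
  proof (rule smooth_on_cong)
    show "smooth_on (\<phi> ` M) (\<lambda>y. y)"
      by (rule smooth_onI_open[OF open_UNIV]) (auto intro: Ck_on_linear bounded_linear_ident)
    show "y = (\<psi> \<circ> F \<circ> inv_into M \<phi>) y" if "y \<in> \<phi> ` M" for y
      using that by (simp add: eq inv_into_into f_inv_into_f)
  qed
  then show ?thesis
    unfolding smooth_map_def using assms(1-3) by blast
qed

theorem theorem3p1:
  shows "\<exists>F. (\<forall>x\<in>Sigma1. F (orbit x) = KS x) \<and>
    symplectomorphism V1 V1_charts omega1 TIH TIH_charts (restrict_form canonical_form) F"
proof (intro exI conjI)
  show "\<forall>x\<in>Sigma1. KS_quotient (orbit x) = KS x" by simp
  note bij = bij_betw_KS_quotient
  have "smooth_map V1 V1_charts TIH_charts KS_quotient"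
    by (rule smooth_map_global_charts[OF coords_KS_quotient_chart coords_chart])
      (use bij in \<open>auto simp: bij_betw_def\<close>)
  moreover have "smooth_map TIH TIH_charts V1_charts (inv_into V1 KS_quotient)"
    by (rule smooth_map_global_charts[OF coords_chart coords_KS_quotient_chart])
      (use bij in \<open>auto simp: bij_betw_def inv_into_into f_inv_into_f\<close>)
  ultimately have "diffeomorphism V1 V1_charts TIH TIH_charts KS_quotient"
    by (simp add: diffeomorphism_def bij)
  moreover have "restrict_form canonical_form (V, \<psi>) (\<psi> (KS_quotient p))
        (frechet_derivative (\<psi> \<circ> KS_quotient \<circ> inv_into U \<phi>) (at (\<phi> p)) u)
        (frechet_derivative (\<psi> \<circ> KS_quotient \<circ> inv_into U \<phi>) (at (\<phi> p)) v)
      = omega1 (U, \<phi>) (\<phi> p) u v"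
    if chart: "(U, \<phi>) \<in> V1_charts" and chart': "(V, \<psi>) \<in> TIH_charts"
      and p: "p \<in> U" "KS_quotient p \<in> V" for U \<phi> V \<psi> p u v
  proof -
    note quotient = chart[unfolded V1_charts_def]
    have U: "U \<subseteq> orbit ` Sigma1" "inj_on \<phi> U" "open (\<phi> ` U)"
      using quotient by (simp_all add: quotient_charts_def)
    obtain x where x: "x \<in> Sigma1" "p = orbit x" using U(1) p(1) by blast
    then have xU: "orbit x \<in> U" using p(1) by simp
    obtain D where D: "((\<phi> \<circ> orbit) has_derivative D) (at x within Sigma1)"
      by (rule quotient_chart_has_derivative[OF quotient x(1) xU])
    obtain G where "(KS_quotient \<circ> inv_into U \<phi> has_derivative G) (at (\<phi> (orbit x)))"
      by (rule quotient_chart_compose_KS_quotient_inverse[OF chart x(1) xU D])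
    then have G: "(KS_quotient \<circ> inv_into U \<phi> has_derivative G) (at (\<phi> p))" by (simp only: x(2))
    \<comment> \<open>The value of \<open>omega1\<close> is fixed by uniqueness, although it is chosen arbitrarily among the
      reduced forms.\<close>
    have "omega1 (U, \<phi>) (\<phi> p) u v = KS_pullback (U, \<phi>) (\<phi> p) u v"
      using reduced_form_unique[OF reduced_form_omega1 reduced_form_KS_pullback quotient x(1) xU D]
      by (simp add: x(2))
    also have "\<dots> = canonical_form (G u) (G v)"
      by (simp add: KS_pullback_def frechet_derivative_at[OF G, symmetric])
    also have "\<dots> = restrict_form canonical_form (V, \<psi>) (\<psi> ((KS_quotient \<circ> inv_into U \<phi>) (\<phi> p)))
        (frechet_derivative (\<psi> \<circ> (KS_quotient \<circ> inv_into U \<phi>)) (at (\<phi> p)) u)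
        (frechet_derivative (\<psi> \<circ> (KS_quotient \<circ> inv_into U \<phi>)) (at (\<phi> p)) v)"
    proof (rule restrict_form_pullback[OF chart'[unfolded TIH_charts_def] G _ U(3), symmetric])
      show "(KS_quotient \<circ> inv_into U \<phi>) (\<phi> p) \<in> V" using p by (simp add: inv_into_f_f[OF U(2)])
      show "\<phi> p \<in> \<phi> ` U" using p(1) by blast
      show "(KS_quotient \<circ> inv_into U \<phi>) ` \<phi> ` U \<subseteq> TIH"
        using bij_betwE[OF bij] U(1) inv_into_into[of _ \<phi> U] unfolding V1_def by fastforce
    qed
    finally show ?thesis
      using p(1) by (simp add: inv_into_f_f[OF U(2)] comp_assoc)
  qed
  ultimately show "symplectomorphism V1 V1_charts omega1 TIH TIH_charts
      (restrict_form canonical_form) KS_quotient"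
    unfolding symplectomorphism_def Let_def by blast
qed

end
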